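(* Let $q$ be a power of $2$, let $m$ be an even positive integer, and let $a\in\mathbb{F}_q^*$. Let $f$ be a non-degenerate quadratic form over $\mathbb{F}_{q^m}$ which is equivalent to Type I. Let $D_f=\{x\in\mathbb{F}_{q^m}: f(x)=a\}$ and let $\mathcal{C}_{D_f}=\{(\mathrm{Tr}(xd))_{d\in D_f}: x\in\mathbb{F}_{q^m}\}$, a linear code over $\mathbb{F}_q$ of length $|D_f|$. Then $\mathcal{C}_{D_f}$ has the following weight hierarchy: $$d_r(\mathcal{C}_{D_f})=\begin{cases} q^{m-1}-q^{\frac{m-2}{2}}-q^{m-2}, & \text{if } r=1,\\ q^{m-1}-q^{\frac{m-2}{2}}-q^{m-r-1}-q^{\frac{m-4}{2}}, & \text{if } 2\le r\le \frac{m}{2},\\ q^{m-1}-q^{\frac{m-2}{2}}-q^{m-r-1}-q^{m-r-2}, & \text{if } \frac{m}{2}<r<m-1,\\ q^{m-1}-q^{\frac{m-2}{2}}-1, & \text{if } r=m-1,\\ q^{m-1}-q^{\frac{m-2}{2}}, & \text{if } r=m.\end{cases}$$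
   Context: $\mathrm{Tr}$ is the trace from $\mathbb{F}_{q^m}$ to $\mathbb{F}_q$. Generalized Hamming weights: for a $k$-dimensional linear code $\mathcal{C}\subseteq\mathbb{F}_q^n$ and an $\mathbb{F}_q$-subspace $H$ of $\mathcal{C}$, $\mathrm{supp}(H)=\{i: c_i\ne 0 \text{ for some } (c_1,\dots,c_n)\in H\}$. For $1\le r\le k$, $d_r(\mathcal{C})=\min\{|\mathrm{supp}(H)| : H \text{ an } r\text{-dimensional subspace of } \mathcal{C}\}$; the set $\{d_1(\mathcal C),\dots,d_k(\mathcal C)\}$ is the weight hierarchy of $\mathcal{C}$. Quadratic forms: fix a basis $\varepsilon_1,\dots,\varepsilon_m$ of $\mathbb{F}_{q^m}$ over $\mathbb{F}_q$ and identify $x=\sum x_i\varepsilon_i$ with $(x_1,\dots,x_m)\in\mathbb{F}_q^m$. A quadratic form over $\mathbb{F}_{q^m}$ is a map $f:\mathbb{F}_{q^m}\to\mathbb{F}_q$ of the form $f(x)=\sum_{1\le i\le j\le m}a_{ij}x_ix_j$ with $a_{ij}\in\mathbb{F}_q$. Put $\ker f=\{x\in\mathbb{F}_{q^m}: f(x+y)=f(y)\text{ for all }y\in\mathbb{F}_{q^m}\}$ (an $\mathbb{F}_q$-subspace). $f$ is non-degenerate if $\ker f=\{0\}$, and degenerate otherwise; $\mathrm{rank}\, f=m-\dim_{\mathbb{F}_q}\ker f$. Types: a quadratic form of rank $t$ is equivalent, under an invertible $\mathbb{F}_q$-linear change of coordinates, to exactly one of: Type I ($t$ even): $x_1x_2+x_3x_4+\cdots+x_{t-1}x_t$;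 Type II ($t$ even): $x_1x_2+\cdots+x_{t-3}x_{t-2}+\alpha x_{t-1}^2+x_{t-1}x_t+\alpha x_t^2$ with $\alpha\in\mathbb{F}_q\setminus\{x^2+x: x\in\mathbb{F}_q\}$; Type III ($t$ odd): $x_1x_2+\cdots+x_{t-2}x_{t-1}+x_t^2$.
   Formalization: The case q = 2, m = 2 is excluded, since there D_f is a single point, the code has dimension 1 and d_1 = 1, whereas the stated formula gives 0 and d_2 does not exist. *)

theory Defs
  imports "HOL-Analysis.Cartesian_Space"
begin

text \<open>An extension of finite fields is given by two types \<open>'k\<close> (of cardinality \<open>q\<close>) and \<open>'l\<close>
  (of cardinality \<open>q ^ m\<close>) and an embedding \<open>emb\<close> of \<open>'k\<close> into \<open>'l\<close>.\<close>

locale field_embedding =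
  fixes emb :: "'k::field \<Rightarrow> 'l::field"
  assumes emb_one: "emb 1 = 1"
    and emb_add: "emb (x + y) = emb x + emb y"
    and emb_mult: "emb (x * y) = emb x * emb y"

definition ext_scale :: "('k \<Rightarrow> 'l) \<Rightarrow> 'k \<Rightarrow> 'l \<Rightarrow> 'l::field" where
  "ext_scale emb c x = emb c * x"

lemma vector_space_ext_scale:
  assumes "field_embedding emb"
  shows "vector_space (ext_scale emb)"
proof -
  interpret field_embedding emb by fact
  show ?thesis
    by unfold_locales (simp_all add: ext_scale_def emb_one emb_add emb_mult algebra_simps)
qed

abbreviation ext_dim :: "('k::field \<Rightarrow> 'l::field) \<Rightarrow> 'l set \<Rightarrow> nat" where
  "ext_dim emb \<equiv> vector_space.dim (ext_scale emb)"

text \<open>If \<open>emb\<close> has degree \<open>m\<close>, the sum below is fixed by \<open>x \<mapsto> x ^ q\<close>, so it lies in the range of \<open>emb\<close> and \<open>inv emb\<close>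
  reads it as an element of \<open>F\<^sub>q\<close>.\<close>

definition field_trace :: "('k::{field,finite} \<Rightarrow> 'l::{field,finite}) \<Rightarrow> nat \<Rightarrow> 'l \<Rightarrow> 'k" where
  "field_trace emb m x = inv emb (\<Sum>i<m. x ^ (CARD('k) ^ i))"


subsection \<open>Quadratic forms\<close>

definition is_ext_basis :: "('k::field \<Rightarrow> 'l::field) \<Rightarrow> nat \<Rightarrow> (nat \<Rightarrow> 'l) \<Rightarrow> bool" where
  "is_ext_basis emb m \<epsilon> \<longleftrightarrow>
     inj_on \<epsilon> {1..m} \<and>
     \<not> module.dependent (ext_scale emb) (\<epsilon> ` {1..m}) \<and>
     module.span (ext_scale emb) (\<epsilon> ` {1..m}) = UNIV"

definition ext_coord :: "('k::field \<Rightarrow> 'l::field) \<Rightarrow> nat \<Rightarrow> (nat \<Rightarrow> 'l) \<Rightarrow> 'l \<Rightarrow> nat \<Rightarrow> 'k" where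
  "ext_coord emb m \<epsilon> x i = module.representation (ext_scale emb) (\<epsilon> ` {1..m}) x (\<epsilon> i)"

definition is_quadratic_form ::
  "('k::field \<Rightarrow> 'l::field) \<Rightarrow> nat \<Rightarrow> (nat \<Rightarrow> 'l) \<Rightarrow> ('l \<Rightarrow> 'k) \<Rightarrow> bool" where
  "is_quadratic_form emb m \<epsilon> f \<longleftrightarrow>
     (\<exists>A :: nat \<Rightarrow> nat \<Rightarrow> 'k. \<forall>x.
        f x = (\<Sum>i=1..m. \<Sum>j=i..m. A i j * ext_coord emb m \<epsilon> x i * ext_coord emb m \<epsilon> x j))"

definition form_ker :: "('l::field \<Rightarrow> 'k::field) \<Rightarrow> 'l set" where
  "form_ker f = {x. \<forall>y. f (x + y) = f y}"

definition nondegenerate :: "('l::field \<Rightarrow> 'k::field) \<Rightarrow> bool" where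
  "nondegenerate f \<longleftrightarrow> form_ker f = {0}"

definition form_rank :: "('k::field \<Rightarrow> 'l::field) \<Rightarrow> nat \<Rightarrow> ('l \<Rightarrow> 'k) \<Rightarrow> nat" where
  "form_rank emb m f = m - ext_dim emb (form_ker f)"

definition equivalent_forms ::
  "('k::field \<Rightarrow> 'l::field) \<Rightarrow> ('l \<Rightarrow> 'k) \<Rightarrow> ('l \<Rightarrow> 'k) \<Rightarrow> bool" where
  "equivalent_forms emb f g \<longleftrightarrow>
     (\<exists>T. Vector_Spaces.linear (ext_scale emb) (ext_scale emb) T \<and> bij T \<and> (\<forall>x. f (T x) = g x))"

text \<open>\<open>x\<^sub>1 x\<^sub>2 + x\<^sub>3 x\<^sub>4 + \<dots> + x\<^sub>t\<^sub>-\<^sub>1 x\<^sub>t\<close> for even \<open>t\<close>\<close>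

definition type_I_form ::
  "('k::field \<Rightarrow> 'l::field) \<Rightarrow> nat \<Rightarrow> (nat \<Rightarrow> 'l) \<Rightarrow> nat \<Rightarrow> 'l \<Rightarrow> 'k" where
  "type_I_form emb m \<epsilon> t x =
     (\<Sum>i=1..t div 2. ext_coord emb m \<epsilon> x (2 * i - 1) * ext_coord emb m \<epsilon> x (2 * i))"

definition is_type_I ::
  "('k::field \<Rightarrow> 'l::field) \<Rightarrow> nat \<Rightarrow> (nat \<Rightarrow> 'l) \<Rightarrow> ('l \<Rightarrow> 'k) \<Rightarrow> bool" where
  "is_type_I emb m \<epsilon> f \<longleftrightarrow>
     even (form_rank emb m f) \<and>
     equivalent_forms emb f (type_I_form emb m \<epsilon> (form_rank emb m f))"


subsection \<open>Linear codes and generalized Hamming weights\<close>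

definition code_supp :: "('k::field ^ 'n) set \<Rightarrow> 'n set" where
  "code_supp H = {i. \<exists>c\<in>H. c $ i \<noteq> 0}"

text \<open>Over a finite field the set below is finite; it is nonempty precisely when \<open>r \<le> vec.dim C\<close>
  (\<open>C\<close> a subspace), and for larger \<open>r\<close> the value is unspecified.\<close>

definition gen_hamming_weight :: "('k::{field,finite} ^ 'n::finite) set \<Rightarrow> nat \<Rightarrow> nat" where
  "gen_hamming_weight C r =
     Min {card (code_supp H) | H. vec.subspace H \<and> H \<subseteq> C \<and> vec.dim H = r}"

text \<open>The code of a defining set \<open>D\<close>, whose elements are enumerated by \<open>\<delta>\<close> (a bijection from the
  index type \<open>'n\<close> onto \<open>D\<close>), so that \<open>CARD('n) = card D\<close> is the length.\<close>

definition trace_code ::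
  "('k::{field,finite} \<Rightarrow> 'l::{field,finite}) \<Rightarrow> nat \<Rightarrow> ('n::finite \<Rightarrow> 'l) \<Rightarrow> ('k ^ 'n) set" where
  "trace_code emb m \<delta> = {(\<chi> i. field_trace emb m (x * \<delta> i)) | x. True}"

end

theory Submission
  imports Defs "HOL-Computational_Algebra.Polynomial"
begin

text \<open>
  The trace form \<open>(x, y) \<mapsto> Tr (x y)\<close> is nondegenerate, so the support of an \<open>r\<close>-dimensional subcode
  misses exactly the points of \<open>D\<^sub>f\<close> in a subspace \<open>U\<close> of dimension \<open>m - r\<close>, and every such \<open>U\<close> occurs.
  Hence \<open>d\<^sub>r = |D\<^sub>f| - max |U \<inter> D\<^sub>f|\<close>.

  To count the solutions of \<open>f = a\<close> in \<open>U\<close>, take a totally singular \<open>P \<subseteq> U\<close> such that all singular vectors of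
  \<open>W = U \<inter> P\<^sup>\<bottom>\<close> lie in \<open>P\<close>. Outside \<open>W\<close> the form is balanced on the cosets of \<open>P\<close>; inside \<open>W\<close> all nonzero
  values are taken equally often, since in characteristic 2 every scalar is a square. So the count is
  \<open>(|U| - |W|) / q + (|W| - |P|) / (q - 1)\<close>. If \<open>P\<close> is maximal then \<open>dim W - dim P \<le> 2\<close>, and only the value 2
  (an anisotropic plane \<open>W / P\<close>) gives more than \<open>q\<^sup>s\<^sup>-\<^sup>1\<close> solutions, \<open>s = dim U\<close>, namely \<open>q\<^sup>s\<^sup>-\<^sup>1 + q\<^sup>p\<close> with
  \<open>p = dim P\<close>. There \<open>p \<le> s - 2\<close>, and \<open>p \<le> m / 2 - 2\<close>: otherwise \<open>W = P\<^sup>\<bottom>\<close>, and the same formula for the whole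
  space contradicts the number of solutions of a form of Type I.
\<close>

subsection \<open>Finite vector spaces and nondegenerate forms\<close>

locale finite_vector_space = finite_dimensional_vector_space scale Basis
  for scale :: "'k::{field,finite} \<Rightarrow> 'v::{ab_group_add,finite} \<Rightarrow> 'v" (infixr "\<cdot>" 75)
    and Basis :: "'v set"
begin

lemma CARD_ge_2: "2 \<le> CARD('k)"
  using card_mono[of "UNIV :: 'k set" "{0, 1}"] by auto

lemma card_span_insert:
  assumes "x \<notin> span S"
  shows "card (span (insert x S)) = CARD('k) * card (span S)"
proof -
  have "bij_betw (\<lambda>(c, y). c \<cdot> x + y) (UNIV \<times> span S) (span (insert x S))"
  proof (rule bij_betw_imageI)
    show "inj_on (\<lambda>(c, y). c \<cdot> x + y) (UNIV \<times> span S)"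
    proof (intro inj_onI, clarsimp)
      fix c d y z
      assume y: "y \<in> span S" and z: "z \<in> span S" and eq: "c \<cdot> x + y = d \<cdot> x + z"
      have "(c - d) \<cdot> x = z - y"
        using eq by (simp add: scale_left_diff_distrib algebra_simps)
      then have d: "(c - d) \<cdot> x \<in> span S"
        using y z by (simp add: span_diff)
      have "c = d"
      proof (rule ccontr)
        assume "c \<noteq> d"
        then have "x = inverse (c - d) \<cdot> ((c - d) \<cdot> x)" by simp
        then show False using span_scale[OF d] assms by metis
      qed
      then show "c = d \<and> y = z" using eq by simp
    qed
    show "(\<lambda>(c, y). c \<cdot> x + y) ` (UNIV \<times> span S) = span (insert x S)"
    proof (intro equalityI subsetI)
      fix z assume "z \<in> (\<lambda>(c, y). c \<cdot> x + y) ` (UNIV \<times> span S)"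
      then obtain c y where "y \<in> span S" "z = c \<cdot> x + y" by auto
      then show "z \<in> span (insert x S)"
        unfolding span_insert by (intro CollectI exI[of _ c]) simp
    next
      fix z assume "z \<in> span (insert x S)"
      then obtain k where "z - k \<cdot> x \<in> span S" by (auto simp: span_insert)
      then show "z \<in> (\<lambda>(c, y). c \<cdot> x + y) ` (UNIV \<times> span S)"
        by (intro image_eqI[of _ _ "(k, z - k \<cdot> x)"]) auto
    qed
  qed
  then show ?thesis
    using bij_betw_same_card[of _ "UNIV \<times> span S" "span (insert x S)"]
    by (metis card_cartesian_product)
qed

lemma card_subspace:
  assumes "subspace S"
  shows "card S = CARD('k) ^ dim S"
proof -
  have "independent C \<Longrightarrow> card (span C) = CARD('k) ^ card C" if "finite C" for C
    using that
  proof (induction C)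
    case (insert x C)
    then have "x \<notin> span C" "independent C"
      by (auto simp: independent_insert)
    with insert show ?case by (simp add: card_span_insert)
  qed simp
  moreover obtain C where "independent C" "span C = S" "card C = dim S"
    using basis_exists[of S] assms by (metis span_minimal subset_antisym)
  ultimately show ?thesis by fastforce
qed

text \<open>Dimensions are obtained throughout by counting points; since
  \<open>CARD('k) \<ge> 2\<close>, the cardinality determines the exponent.\<close>

lemma dim_eqI:
  assumes "subspace S" "card S = CARD('k) ^ d"
  shows "dim S = d"
  using assms card_subspace[of S] CARD_ge_2 by simp

text \<open>Every fibre is a translate of a fibre, and the fibre over \<open>c\<close> contains a multiple of a vector
  on which the functional does not vanish.\<close>

lemma card_functional_fibre:
  assumes S: "subspace S"
    and add: "\<And>x y. \<phi> (x + y) = \<phi> x + \<phi> y" and scale: "\<And>b x. \<phi> (b \<cdot> x) = b * \<phi> x"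
    and nz: "x \<in> S" "\<phi> x \<noteq> (0 :: 'k)"
  shows "CARD('k) * card {y\<in>S. \<phi> y = c} = card S"
proof -
  define z where "z = inverse (\<phi> x) \<cdot> x"
  have z: "z \<in> S" "\<phi> z = 1"
    using S nz by (auto simp: z_def scale subspace_scale)
  have fibre: "card {y\<in>S. \<phi> y = d} = card {y\<in>S. \<phi> y = c}" for d
  proof (rule bij_betw_same_card)
    show "bij_betw (\<lambda>y. y + (c - d) \<cdot> z) {y\<in>S. \<phi> y = d} {y\<in>S. \<phi> y = c}"
      by (rule bij_betw_byWitness[where f' = "\<lambda>y. y + (d - c) \<cdot> z"])
        (auto simp: add scale z S subspace_add subspace_scale add.assoc simp flip: scale_left_distrib)
  qed
  have "card S = (\<Sum>d\<in>UNIV. card {y\<in>S. \<phi> y = d})"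
    by (subst card_UN_disjoint[symmetric]) (auto intro!: arg_cong[where f = card])
  also have "\<dots> = (\<Sum>d\<in>(UNIV :: 'k set). card {y\<in>S. \<phi> y = c})"
    by (rule sum.cong[OF refl fibre])
  finally show ?thesis by simp
qed

end

text \<open>Only symmetry is asked of \<open>B\<close>, so that the locale covers both the trace
  form and the polar form of a quadratic form.\<close>

locale nondegenerate_form = finite_vector_space scale Basis
  for scale :: "'k::{field,finite} \<Rightarrow> 'v::{ab_group_add,finite} \<Rightarrow> 'v" (infixr "\<cdot>" 75)
    and Basis :: "'v set" +
  fixes B :: "'v \<Rightarrow> 'v \<Rightarrow> 'k"
  assumes B_add: "B (x + y) z = B x z + B y z"
    and B_scale: "B (c \<cdot> x) z = c * B x z"
    and B_sym: "B x y = B y x"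
    and B_nondeg: "(\<And>y. B x y = 0) \<Longrightarrow> x = 0"
begin

definition perp :: "'v set \<Rightarrow> 'v set" where
  "perp S = {x. \<forall>y\<in>S. B x y = 0}"

lemma B_add_right: "B z (x + y) = B z x + B z y"
  using B_add B_sym by metis

lemma B_scale_right: "B z (c \<cdot> x) = c * B z x"
  using B_scale B_sym by metis

lemma B_zero [simp]: "B 0 x = 0" "B x 0 = 0"
  using B_scale[of 0 0 x] B_scale_right[of x 0 0] by auto

lemma subspace_perp: "subspace (perp S)"
  by (rule subspaceI) (auto simp: perp_def B_add B_scale)

text \<open>Double counting of the pairs \<open>(x, y)\<close> with \<open>y \<in> S\<close> and \<open>B x y = 0\<close>.\<close>

lemma card_perp:
  assumes S: "subspace S"
  shows "card S * card (perp S) = CARD('v)"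
proof -
  let ?q = "CARD('k)"
  \<comment> \<open>Multiplying row and column counts by \<open>?q\<close> avoids division: a
    hyperplane section has a \<open>?q\<close>-th of the points.\<close>
  have row: "?q * card {y\<in>S. B x y = 0} = (if x \<in> perp S then ?q * card S else card S)" for x
  proof (cases "x \<in> perp S")
    case True
    then have "{y\<in>S. B x y = 0} = S" by (auto simp: perp_def)
    then show ?thesis using True by simp
  next
    case False
    then obtain y where "y \<in> S" "B x y \<noteq> 0" by (auto simp: perp_def)
    then show ?thesis
      using card_functional_fibre[OF S, of "B x" y 0] False by (simp add: B_add_right B_scale_right)
  qed
  have col: "?q * card {x. B x y = 0} = (if y = 0 then ?q * CARD('v) else CARD('v))" for y
  proof (cases "y = 0")
    case False
    then obtain x where "B x y \<noteq> 0" using B_nondeg B_sym by metis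
    then show ?thesis
      using card_functional_fibre[OF subspace_UNIV, of "\<lambda>x. B x y" x 0] False
      by (simp add: B_add B_scale)
  qed simp
  have "(\<Sum>x\<in>UNIV. card {y\<in>S. B x y = 0}) = (\<Sum>y\<in>S. card {x\<in>UNIV. B x y = 0})"
    by (rule sum_multicount_gen) simp_all
  then have "(\<Sum>x\<in>UNIV. ?q * card {y\<in>S. B x y = 0}) = (\<Sum>y\<in>S. ?q * card {x. B x y = 0})"
    by (simp flip: sum_distrib_left)
  moreover have "(\<Sum>x\<in>UNIV. ?q * card {y\<in>S. B x y = 0})
      = card (perp S) * (?q * card S) + (CARD('v) - card (perp S)) * card S"
    by (simp add: row sum.If_cases card_Diff_subset Compl_eq_Diff_UNIV)
  moreover have "(\<Sum>y\<in>S. ?q * card {x. B x y = 0}) = ?q * CARD('v) + (card S - 1) * CARD('v)"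
    using subspace_0[OF S] by (simp add: col sum.remove[of S 0])
  ultimately have "int (card (perp S) * (?q * card S) + (CARD('v) - card (perp S)) * card S)
      = int (?q * CARD('v) + (card S - 1) * CARD('v))"
    by (intro arg_cong[where f = int]) simp
  moreover have "card (perp S) \<le> CARD('v)" "1 \<le> card S"
    using subspace_0[OF S] by (auto intro: card_mono simp: Suc_le_eq card_gt_0_iff)
  \<comment> \<open>The two counts differ by \<open>card S * CARD('v)\<close> on both sides; what
    remains has the common factor \<open>?q - 1\<close>, nonzero because
    \<open>?q \<ge> 2\<close>.\<close>
  ultimately have "(int ?q - 1) * (int (card S) * int (card (perp S))) = (int ?q - 1) * int CARD('v)"
    by (simp only: of_nat_add of_nat_mult of_nat_diff) (simp add: algebra_simps)
  moreover have "2 \<le> ?q" by (rule CARD_ge_2)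
  ultimately have "int (card S) * int (card (perp S)) = int CARD('v)"
    by simp
  then show ?thesis
    by (metis of_nat_eq_iff of_nat_mult)
qed

lemma dim_perp:
  assumes "subspace S"
  shows "dim S + dim (perp S) = dim (UNIV :: 'v set)"
proof -
  have "CARD('k) ^ (dim S + dim (perp S)) = CARD('k) ^ dim (UNIV :: 'v set)"
    using card_perp[OF assms] card_subspace[OF assms] card_subspace[OF subspace_perp]
      card_subspace[OF subspace_UNIV]
    by (simp add: power_add)
  then show ?thesis using CARD_ge_2 by simp
qed

text \<open>One inclusion is symmetry, the dimensions agree. So every subspace is a
  \<open>perp\<close>, which later realises any prescribed zero set by a subcode.\<close>

lemma perp_perp:
  assumes S: "subspace S"
  shows "perp (perp S) = S"
proof -
  have "S \<subseteq> perp (perp S)" using B_sym by (auto simp: perp_def)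
  moreover have "dim (perp (perp S)) = dim S"
    using dim_perp[OF S] dim_perp[OF subspace_perp] by (metis add_left_cancel add.commute)
  ultimately show ?thesis
    using subspace_dim_equal[OF S subspace_perp, of "perp S"] by simp
qed

end

subsection \<open>Quadratic forms in characteristic 2\<close>

locale quadratic_space = nondegenerate_form scale Basis B
  for scale :: "'k::{field,finite} \<Rightarrow> 'v::{ab_group_add,finite} \<Rightarrow> 'v" (infixr "\<cdot>" 75)
    and Basis :: "'v set" and B :: "'v \<Rightarrow> 'v \<Rightarrow> 'k" +
  fixes Q :: "'v \<Rightarrow> 'k"
  assumes Q_add: "Q (x + y) = Q x + Q y + B x y"
    and Q_scale: "Q (c \<cdot> x) = c\<^sup>2 * Q x"
    and char_2: "(1 :: 'k) + 1 = 0"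
begin

abbreviation (input) level :: "'v set \<Rightarrow> 'k \<Rightarrow> 'v set" where
  "level U a \<equiv> {x\<in>U. Q x = a}"

lemma add_self: "c + c = (0 :: 'k)"
  using char_2 by (metis distrib_left mult.right_neutral mult_zero_right)

text \<open>In characteristic 2, equal squares give \<open>(x + y)\<^sup>2 = 0\<close>, so squaring
  is injective, hence surjective on a finite field.\<close>

lemma square_surj: "\<exists>c :: 'k. c\<^sup>2 = d"
proof -
  have "inj (\<lambda>c :: 'k. c\<^sup>2)"
  proof (rule injI)
    fix x y :: 'k assume "x\<^sup>2 = y\<^sup>2"
    then have "(x + y)\<^sup>2 = (y\<^sup>2 + y\<^sup>2) + (x * y + x * y)"
      by (simp only: power2_eq_square distrib_left distrib_right mult.commute[of y x] add_ac)
    then have "(x + y)\<^sup>2 = 0"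
      by (simp only: add_self)
    then have "x + y = y + y" using add_self by simp
    then show "x = y" by simp
  qed
  then have "surj (\<lambda>c :: 'k. c\<^sup>2)" by (simp add: finite_UNIV_inj_surj)
  then show ?thesis by (metis surjD)
qed

lemma Q_zero [simp]: "Q 0 = 0"
  using Q_scale[of 0 0] by simp

text \<open>Rescaling by square roots makes all nonzero levels of \<open>W\<close> equinumerous.\<close>

lemma card_level_definite:
  assumes W: "subspace W" and P: "P \<subseteq> W" "\<And>x. x \<in> P \<Longrightarrow> Q x = 0"
    and def: "\<And>x. x \<in> W \<Longrightarrow> Q x = 0 \<Longrightarrow> x \<in> P" and a: "a \<noteq> 0"
  shows "(CARD('k) - 1) * card (level W a) = card W - card P"
proof -
  have "card (level W b) = card (level W a)" if b: "b \<noteq> 0" for b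
  proof -
    obtain c where c: "c\<^sup>2 = a / b" using square_surj by blast
    then have "c \<noteq> 0" using a b by auto
    show ?thesis
    proof (rule bij_betw_same_card)
      show "bij_betw (\<lambda>x. c \<cdot> x) (level W b) (level W a)"
        by (rule bij_betw_byWitness[where f' = "\<lambda>x. inverse c \<cdot> x"])
          (use \<open>c \<noteq> 0\<close> a b in \<open>auto simp: Q_scale subspace_scale W c power_inverse\<close>)
    qed
  qed
  moreover have "card (W - P) = (\<Sum>b\<in>- {0}. card (level W b))"
    by (subst card_UN_disjoint[symmetric]) (use def P in \<open>auto intro!: arg_cong[where f = card]\<close>)
  moreover have "card (W - P) = card W - card P"
    using P by (simp add: card_Diff_subset)
  ultimately show ?thesis by (simp add: card_Diff_subset Compl_eq_Diff_UNIV)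
qed

text \<open>On a coset \<open>u + P\<close> with \<open>u \<notin> P\<^sup>\<bottom>\<close> the form is affine and nonconstant, so it takes the value \<open>a\<close>
  on exactly \<open>|P| / q\<close> points.\<close>

lemma card_level_outside:
  assumes U: "subspace U" and P: "subspace P" "P \<subseteq> U" "\<And>x. x \<in> P \<Longrightarrow> Q x = 0"
  shows "CARD('k) * card (level (U - perp P) a) = card U - card (U \<inter> perp P)"
proof -
  let ?q = "CARD('k)"
  define D where "D = U - perp P"
  have shift: "u + w \<in> D \<longleftrightarrow> u \<in> D" if "w \<in> P" for u w
  proof -
    \<comment> \<open>A totally singular subspace is orthogonal to itself, by polarization.\<close>
    have "B w y = 0" if "y \<in> P" for y
      using Q_add[of w y] P \<open>w \<in> P\<close> that by (simp add: subspace_add)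
    then have "u + w \<in> perp P \<longleftrightarrow> u \<in> perp P" by (auto simp: perp_def B_add)
    moreover have "u + w \<in> U \<longleftrightarrow> u \<in> U"
      using U P \<open>w \<in> P\<close> subspace_add[OF U] subspace_diff[OF U, of "u + w" w] by auto
    ultimately show ?thesis by (simp add: D_def)
  qed
  have row: "?q * card {w\<in>P. Q (u + w) = a} = card P" if u: "u \<in> D" for u
  proof -
    obtain y where "y \<in> P" "B u y \<noteq> 0" using u by (auto simp: D_def perp_def)
    then have "?q * card {w\<in>P. B u w = a - Q u} = card P"
      using card_functional_fibre[OF P(1), of "B u"] by (auto simp: B_add_right B_scale_right)
    moreover have "{w\<in>P. Q (u + w) = a} = {w\<in>P. B u w = a - Q u}"
      using Q_add[of u] P by (auto simp: algebra_simps)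
    ultimately show ?thesis by simp
  qed
  have col: "card {u\<in>D. Q (u + w) = a} = card (level D a)" if w: "w \<in> P" for w
  proof (rule bij_betw_same_card)
    show "bij_betw (\<lambda>u. u + w) {u\<in>D. Q (u + w) = a} (level D a)"
    proof (rule bij_betw_byWitness[where f' = "\<lambda>u. u - w"])
      have "u - w \<in> D" if "u \<in> D" for u
        using shift[OF w, of "u - w"] that by simp
      then show "(\<lambda>u. u - w) ` level D a \<subseteq> {u\<in>D. Q (u + w) = a}" by auto
      show "(\<lambda>u. u + w) ` {u\<in>D. Q (u + w) = a} \<subseteq> level D a"
        using shift[OF w] by blast
    qed simp_all
  qed
  \<comment> \<open>Double counting of the pairs \<open>(u, w)\<close> in
    \<open>D \<times> P\<close> with \<open>Q (u + w) = a\<close> replaces a choice of coset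
    representatives.\<close>
  have "card P * card D = (\<Sum>u\<in>D. ?q * card {w\<in>P. Q (u + w) = a})"
    using sum.cong[OF refl row, of D] by simp
  also have "\<dots> = ?q * (\<Sum>u\<in>D. card {w\<in>P. Q (u + w) = a})"
    by (rule sum_distrib_left[symmetric])
  also have "(\<Sum>u\<in>D. card {w\<in>P. Q (u + w) = a}) = (\<Sum>w\<in>P. card {u\<in>D. Q (u + w) = a})"
    by (intro sum_multicount_gen[of D P "\<lambda>u w. Q (u + w) = a"] ballI refl finite)
  also have "\<dots> = card P * card (level D a)"
    using sum.cong[OF refl col, of P] by simp
  finally have "card P * card D = card P * (?q * card (level D a))"
    by (simp add: mult.left_commute)
  moreover have "card P \<noteq> 0" using subspace_0[OF P(1)] by auto
  ultimately have "card D = ?q * card (level D a)" by simp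
  moreover have "card D = card U - card (U \<inter> perp P)"
    unfolding D_def by (metis card_Diff_subset_Int finite)
  ultimately show ?thesis by (simp add: D_def)
qed

text \<open>The first summand counts the points outside \<open>perp P\<close>, the second those
  inside. The factor \<open>q * (q - 1)\<close> clears both denominators, and the integers allow the
  differences.\<close>

lemma card_level:
  assumes U: "subspace U" and P: "subspace P" "P \<subseteq> U" "\<And>x. x \<in> P \<Longrightarrow> Q x = 0"
    and def: "\<And>x. x \<in> U \<inter> perp P \<Longrightarrow> Q x = 0 \<Longrightarrow> x \<in> P"
    and W: "dim (U \<inter> perp P) = w" and a: "a \<noteq> 0"
  defines "q \<equiv> int CARD('k)"
  shows "q * (q - 1) * int (card (level U a)) =
    (q - 1) * (q ^ dim U - q ^ w) + q * (q ^ w - q ^ dim P)"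
proof -
  let ?W = "U \<inter> perp P"
  have sW: "subspace ?W" using U subspace_perp by (rule subspace_inter)
  have "B x y = 0" if "x \<in> P" "y \<in> P" for x y
    using Q_add[of x y] P that by (simp add: subspace_add)
  then have PW: "P \<subseteq> ?W" using P by (auto simp: perp_def)
  have q: "1 \<le> CARD('k)" by (simp add: Suc_le_eq)
  have "(CARD('k) - 1) * card (level ?W a) = card ?W - card P"
    by (rule card_level_definite) (use sW PW P def a in auto)
  then have "int ((CARD('k) - 1) * card (level ?W a)) = int (card ?W - card P)"
    by (rule arg_cong)
  then have 1: "(q - 1) * int (card (level ?W a)) = q ^ w - q ^ dim P"
    using card_mono[OF _ PW] q
    by (simp only: of_nat_mult of_nat_diff finite_code q_def card_subspace[OF sW]
        card_subspace[OF P(1)] W of_nat_1 of_nat_power)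
  have "CARD('k) * card (level (U - perp P) a) = card U - card ?W"
    using U P by (rule card_level_outside)
  then have "int (CARD('k) * card (level (U - perp P) a)) = int (card U - card ?W)"
    by (rule arg_cong)
  then have 2: "q * int (card (level (U - perp P) a)) = q ^ dim U - q ^ w"
    using card_mono[of U ?W]
    by (simp only: of_nat_mult of_nat_diff finite_code q_def card_subspace[OF sW]
        card_subspace[OF U] W of_nat_power inf_le1)
  have "level U a = level ?W a \<union> level (U - perp P) a" by auto
  then have "card (level U a) = card (level ?W a) + card (level (U - perp P) a)"
    by (simp add: card_Un_disjoint disjoint_iff)
  then have "q * (q - 1) * int (card (level U a)) =
      q * ((q - 1) * int (card (level ?W a))) + (q - 1) * (q * int (card (level (U - perp P) a)))"
    by (simp add: algebra_simps)
  then show ?thesis by (simp only: 1 2 add.commute)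
qed

section \<open>Maximal totally singular subspaces\<close>

text \<open>\<open>P\<close> is maximal among the totally singular subspaces of \<open>U\<close>. A
  singular vector of \<open>U\<close> orthogonal to \<open>P\<close> spans with \<open>P\<close> a
  totally singular subspace, so it already lies in \<open>P\<close>.\<close>

lemma ex_maximal_singular:
  assumes U: "subspace U"
  obtains P where "subspace P" "P \<subseteq> U" "\<And>x. x \<in> P \<Longrightarrow> Q x = 0"
    "\<And>x. x \<in> U \<inter> perp P \<Longrightarrow> Q x = 0 \<Longrightarrow> x \<in> P"
    "dim P \<le> dim (U \<inter> perp P)" "dim (U \<inter> perp P) \<le> dim P + 2"
proof -
  define \<P> where "\<P> = {P. subspace P \<and> P \<subseteq> U \<and> (\<forall>x\<in>P. Q x = 0)}"
  have "{0} \<in> \<P>" using U by (simp add: \<P>_def subspace_single_0 subspace_0)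
  then obtain P where P: "P \<in> \<P>" and max: "\<And>P'. P' \<in> \<P> \<Longrightarrow> P \<subseteq> P' \<Longrightarrow> P = P'"
    using finite_has_maximal[of \<P>] by (metis empty_iff finite)
  then have sP: "subspace P" and PU: "P \<subseteq> U" and Q0: "\<And>x. x \<in> P \<Longrightarrow> Q x = 0"
    by (auto simp: \<P>_def)
  have insert_span: "\<exists>k y. y \<in> P \<and> z = k \<cdot> x + y" if z: "z \<in> span (insert x P)" for x z
  proof -
    obtain k where "z - k \<cdot> x \<in> P"
      using z unfolding span_insert span_eq_iff[THEN iffD2, OF sP] by blast
    then show ?thesis by (intro exI[of _ k] exI[of _ "z - k \<cdot> x"]) simp
  qed
  define W where "W = U \<inter> perp P"
  have sW: "subspace W" unfolding W_def using U subspace_perp by (rule subspace_inter)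
  have "B x y = 0" if "x \<in> P" "y \<in> P" for x y
    using Q_add[of x y] Q0 sP that by (simp add: subspace_add)
  then have PW: "P \<subseteq> W" using PU by (auto simp: W_def perp_def)
  have sing: "x \<in> P" if x: "x \<in> W" "Q x = 0" for x
  proof -
    have "Q z = 0" "z \<in> U" if z: "z \<in> span (insert x P)" for z
    proof -
      obtain k y where "y \<in> P" "z = k \<cdot> x + y" using insert_span[OF z] by blast
      moreover have "B x y = 0" using x \<open>y \<in> P\<close> by (auto simp: W_def perp_def)
      ultimately show "Q z = 0" "z \<in> U"
        using x Q0 PU U by (auto simp: W_def Q_add Q_scale B_scale intro!: subspace_add subspace_scale)
    qed
    then have "span (insert x P) \<in> \<P>" by (auto simp: \<P>_def)
    moreover have "P \<subseteq> span (insert x P)" by (meson span_superset subset_insertI subset_trans)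
    ultimately have "P = span (insert x P)" by (rule max)
    then show ?thesis using span_base[of x "insert x P"] by auto
  qed
  have "dim W \<le> dim P + 2"
  proof (cases "W = P")
    case False
    then obtain x where x: "x \<in> W" "x \<notin> P" using PW by blast
    then have Qx: "Q x \<noteq> 0" using sing by blast
    \<comment> \<open>\<open>W'\<close> has codimension at most 1 in \<open>W\<close>. For
      \<open>y\<close> in it, a \<open>c\<close> with \<open>c\<^sup>2 * Q x = Q y\<close> makes
      \<open>c \<cdot> x + y\<close> singular, hence an element of \<open>P\<close>. So
      \<open>W'\<close> lies in the span of \<open>x\<close> and \<open>P\<close>, of dimension
      \<open>dim P + 1\<close>.\<close>
    define W' where "W' = {y\<in>W. B x y = 0}"
    have "card W \<le> CARD('k) * card W'"
    proof (cases "\<exists>y\<in>W. B x y \<noteq> 0")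
      case True
      then obtain y where "y \<in> W" "B x y \<noteq> 0" by blast
      then show ?thesis
        using card_functional_fibre[OF sW, of "B x" y 0] by (simp add: W'_def B_add_right B_scale_right)
    next
      case False
      then have "W' = W" by (auto simp: W'_def)
      then show ?thesis by simp
    qed
    also have "card W' \<le> card (span (insert x P))"
    proof (rule card_mono)
      show "W' \<subseteq> span (insert x P)"
      proof
        fix y assume y: "y \<in> W'"
        obtain c where c: "c\<^sup>2 = Q y / Q x" using square_surj by blast
        have "Q (c \<cdot> x + y) = Q y + Q y"
          using y Qx by (simp add: W'_def Q_add Q_scale B_scale c)
        then have "c \<cdot> x + y \<in> P"
          using sing x y sW by (simp add: W'_def add_self subspace_add subspace_scale)
        have "(c \<cdot> x + y) - c \<cdot> x \<in> span (insert x P)"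
          using span_base[of "c \<cdot> x + y" "insert x P"] span_base[of x "insert x P"]
            \<open>c \<cdot> x + y \<in> P\<close> by (simp only: insert_iff span_diff span_scale simp_thms)
        then show "y \<in> span (insert x P)" by simp
      qed
    qed simp
    also have "\<dots> = CARD('k) * card P"
      using card_span_insert[of x P] x unfolding span_eq_iff[THEN iffD2, OF sP] by blast
    finally have "CARD('k) ^ dim W \<le> CARD('k) * (CARD('k) * CARD('k) ^ dim P)"
      by (simp only: card_subspace[OF sW] card_subspace[OF sP] mult_le_mono2)
    also have "\<dots> = CARD('k) ^ (dim P + 2)"
      by (simp only: add_2_eq_Suc' power_Suc)
    finally show ?thesis
      by (rule power_le_imp_le_exp[rotated]) (use CARD_ge_2 in linarith)
  qed simp
  then show thesis
    using that[OF sP PU Q0] sing PW dim_subset[OF PW] by (simp add: W_def)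
qed

section \<open>Solutions in a subspace, by the dimension of \<open>W / P\<close>\<close>

text \<open>If \<open>W\<close> and \<open>P\<close> have equal dimension, the second summand of
  \<open>card_level\<close> vanishes. The additive form avoids a subtraction of naturals.\<close>

lemma card_level_hyperbolic:
  assumes "subspace U" "subspace P" "P \<subseteq> U" "\<And>x. x \<in> P \<Longrightarrow> Q x = 0"
    and "\<And>x. x \<in> U \<inter> perp P \<Longrightarrow> Q x = 0 \<Longrightarrow> x \<in> P"
    and "dim (U \<inter> perp P) = dim P" "a \<noteq> 0"
  shows "CARD('k) * card (level U a) + CARD('k) ^ dim P = CARD('k) ^ dim U"
proof -
  define q where "q = int CARD('k)"
  have "q * (q - 1) * int (card (level U a))
      = (q - 1) * (q ^ dim U - q ^ dim P) + q * (q ^ dim P - q ^ dim P)"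
    using card_level[OF assms] unfolding q_def .
  then have "(q - 1) * (q * int (card (level U a)) + q ^ dim P) = (q - 1) * q ^ dim U"
    by (simp add: algebra_simps)
  moreover have "q \<noteq> 1" using CARD_ge_2 by (simp add: q_def)
  ultimately have "int (CARD('k) * card (level U a) + CARD('k) ^ dim P) = int (CARD('k) ^ dim U)"
    by (simp add: q_def)
  then show ?thesis by (simp only: of_nat_eq_iff)
qed

text \<open>Here \<open>q * (q ^ (p + 1) - q ^ p)\<close> is exactly the
  \<open>(q - 1) * q ^ (p + 1)\<close> subtracted in the first summand, so no correction to
  \<open>q ^ d\<close> remains.\<close>

lemma card_level_parabolic:
  assumes "subspace U" "subspace P" "P \<subseteq> U" "\<And>x. x \<in> P \<Longrightarrow> Q x = 0"
    and "\<And>x. x \<in> U \<inter> perp P \<Longrightarrow> Q x = 0 \<Longrightarrow> x \<in> P"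
    and "dim (U \<inter> perp P) = dim P + 1" "a \<noteq> 0" "dim U = Suc d"
  shows "card (level U a) = CARD('k) ^ d"
proof -
  define q where "q = int CARD('k)"
  have "q * (q - 1) * int (card (level U a))
      = (q - 1) * (q ^ Suc d - q ^ (dim P + 1)) + q * (q ^ (dim P + 1) - q ^ dim P)"
    using card_level[OF assms(1-7)] unfolding q_def assms(8) .
  then have "q * (q - 1) * int (card (level U a)) = q * (q - 1) * q ^ d"
    by (simp add: algebra_simps)
  moreover have "q \<noteq> 1" "q \<noteq> 0" using CARD_ge_2 by (auto simp: q_def)
  ultimately have "int (card (level U a)) = int (CARD('k) ^ d)"
    by (simp add: q_def)
  then show ?thesis by (simp only: of_nat_eq_iff)
qed

text \<open>Now \<open>q * (q ^ (p + 2) - q ^ p) = (q - 1) * (q ^ (p + 2) + q ^ (p + 1))\<close>;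
  after cancellation the surplus over \<open>q ^ d\<close> is \<open>q ^ p\<close>.\<close>

lemma card_level_elliptic:
  assumes "subspace U" "subspace P" "P \<subseteq> U" "\<And>x. x \<in> P \<Longrightarrow> Q x = 0"
    and "\<And>x. x \<in> U \<inter> perp P \<Longrightarrow> Q x = 0 \<Longrightarrow> x \<in> P"
    and "dim (U \<inter> perp P) = dim P + 2" "a \<noteq> 0" "dim U = Suc d"
  shows "card (level U a) = CARD('k) ^ d + CARD('k) ^ dim P"
proof -
  define q where "q = int CARD('k)"
  have "q * (q - 1) * int (card (level U a))
      = (q - 1) * (q ^ Suc d - q ^ (dim P + 2)) + q * (q ^ (dim P + 2) - q ^ dim P)"
    using card_level[OF assms(1-7)] unfolding q_def assms(8) .
  then have "q * (q - 1) * int (card (level U a)) = q * (q - 1) * (q ^ d + q ^ dim P)"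
    by (simp add: algebra_simps)
  moreover have "q \<noteq> 1" "q \<noteq> 0" using CARD_ge_2 by (auto simp: q_def)
  ultimately have "int (card (level U a)) = int (CARD('k) ^ d + CARD('k) ^ dim P)"
    by (simp add: q_def)
  then show ?thesis by (simp only: of_nat_eq_iff)
qed

text \<open>Only the elliptic case exceeds \<open>q ^ d\<close>. The bounds on \<open>p\<close>
  serve different ranges of \<open>d\<close>: \<open>Suc p \<le> d\<close> small subspaces,
  \<open>p + 2 \<le> n\<close> large ones, and \<open>d \<le> 2 * p + 1\<close> excludes a surplus
  in hyperplanes.\<close>

lemma card_level_le:
  assumes U: "subspace U" and a: "a \<noteq> 0" and d: "dim U = Suc d"
    and n: "dim (UNIV :: 'v set) = 2 * n" and total: "card (level UNIV a) < CARD('k) ^ (2 * n - 1)"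
  shows "card (level U a) \<le> CARD('k) ^ d \<or>
    (\<exists>p. Suc p \<le> d \<and> p + 2 \<le> n \<and> d \<le> 2 * p + 1 \<and>
      card (level U a) = CARD('k) ^ d + CARD('k) ^ p)"
proof -
  obtain P where P: "subspace P" "P \<subseteq> U" "\<And>x. x \<in> P \<Longrightarrow> Q x = 0"
      "\<And>x. x \<in> U \<inter> perp P \<Longrightarrow> Q x = 0 \<Longrightarrow> x \<in> P"
    and w: "dim P \<le> dim (U \<inter> perp P)" "dim (U \<inter> perp P) \<le> dim P + 2"
    using ex_maximal_singular[OF U] by blast
  consider "dim (U \<inter> perp P) = dim P" | "dim (U \<inter> perp P) = dim P + 1"
    | "dim (U \<inter> perp P) = dim P + 2"
    using w by linarith
  then show ?thesis
  proof cases
    case 1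
    have "CARD('k) * card (level U a) + CARD('k) ^ dim P = CARD('k) * CARD('k) ^ d"
      using card_level_hyperbolic[OF U P 1 a] unfolding d power_Suc .
    then have "CARD('k) * card (level U a) \<le> CARD('k) * CARD('k) ^ d" by linarith
    then show ?thesis by (intro disjI1) simp
  next
    case 2
    show ?thesis using eq_refl[OF card_level_parabolic[OF U P 2 a d]] by (rule disjI1)
  next
    case 3
    let ?p = "dim P"
    have perp: "?p + dim (perp P) = 2 * n" using dim_perp[OF P(1)] n by simp
    have "?p + 2 \<le> Suc d" using dim_subset[of "U \<inter> perp P" U] 3 d by simp
    \<comment> \<open>The sum of \<open>U\<close> and \<open>perp P\<close> has dimension at most
      \<open>2 * n\<close>, while \<open>perp P\<close> has dimension \<open>2 * n - p\<close> and
      the intersection \<open>p + 2\<close>.\<close>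
    moreover have "d \<le> 2 * ?p + 1"
      using dim_sums_Int[OF U subspace_perp, of P] perp 3 d n
        dim_subset[OF subset_UNIV, of "{x + y |x y. x \<in> U \<and> y \<in> perp P}"] by linarith
    \<comment> \<open>Otherwise \<open>p = n - 1\<close>, and \<open>U \<inter> perp P\<close> fills
      all of \<open>perp P\<close>. Then \<open>P\<close> puts the whole space into the elliptic
      case, against \<open>total\<close>.\<close>
    moreover have "?p + 2 \<le> n"
    proof (rule ccontr)
      have le: "dim (U \<inter> perp P) \<le> dim (perp P)" by (simp add: dim_subset)
      assume "\<not> ?p + 2 \<le> n"
      then have "dim (perp P) \<le> dim (U \<inter> perp P)" "2 * n - 1 = Suc (2 * ?p)" "n = Suc ?p"
        using le perp 3 by linarith+
      then have W: "U \<inter> perp P = perp P"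
        by (intro subspace_dim_equal subspace_inter[OF U] subspace_perp) simp_all
      have "card (level UNIV a) = CARD('k) ^ (2 * n - 1) + CARD('k) ^ ?p"
        by (rule card_level_elliptic[OF subspace_UNIV P(1) subset_UNIV P(3)])
          (use P(4) W 3 a n \<open>n = Suc ?p\<close> in simp_all)
      then show False using total by simp
    qed
    ultimately have "Suc ?p \<le> d \<and> ?p + 2 \<le> n \<and> d \<le> 2 * ?p + 1" by simp
    then show ?thesis using card_level_elliptic[OF U P 3 a d] by blast
  qed
qed

end

subsection \<open>Hyperbolic spaces\<close>

text \<open>Coordinate functions replace a basis here, so that transport along an equivalence of
  forms merely composes them with a linear bijection.\<close>

locale hyperbolic_space = finite_vector_space scale Basis
  for scale :: "'k::{field,finite} \<Rightarrow> 'v::{ab_group_add,finite} \<Rightarrow> 'v" (infixr "\<cdot>" 75)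
    and Basis :: "'v set" +
  fixes n :: nat and X Y :: "'v \<Rightarrow> nat \<Rightarrow> 'k"
  assumes X_add: "X (x + y) i = X x i + X y i" and X_scale: "X (c \<cdot> x) i = c * X x i"
    and Y_add: "Y (x + y) i = Y x i + Y y i" and Y_scale: "Y (c \<cdot> x) i = c * Y x i"
    and coord_inj: "(\<And>i. i < n \<Longrightarrow> X x i = X y i \<and> Y x i = Y y i) \<Longrightarrow> x = y"
    and coord_surj: "\<exists>x. \<forall>i<n. X x i = g i \<and> Y x i = h i"
    and char_2: "(1 :: 'k) + 1 = 0"
begin

definition Q :: "'v \<Rightarrow> 'k" where
  "Q x = (\<Sum>i<n. X x i * Y x i)"

definition B :: "'v \<Rightarrow> 'v \<Rightarrow> 'k" where
  "B x y = (\<Sum>i<n. X x i * Y y i + Y x i * X y i)"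

text \<open>\<open>u\<close> is a hyperbolic basis vector; pairing with it reads off the dual
  coordinate. This gives nondegeneracy and the shape of \<open>perp\<close> below.\<close>

lemma B_unit:
  assumes j: "j < n" and u: "\<And>i. i < n \<Longrightarrow> X u i = (if i = j then 1 else 0) \<and> Y u i = 0"
  shows "B x u = Y x j"
proof -
  have "B x u = (\<Sum>i<n. if i = j then Y x i else 0)"
    unfolding B_def by (rule sum.cong) (auto simp: u)
  then show ?thesis using j by simp
qed

lemma B_unit':
  assumes j: "j < n" and u: "\<And>i. i < n \<Longrightarrow> X u i = 0 \<and> Y u i = (if i = j then 1 else 0)"
  shows "B x u = X x j"
proof -
  have "B x u = (\<Sum>i<n. if i = j then X x i else 0)"
    unfolding B_def by (rule sum.cong) (auto simp: u)
  then show ?thesis using j by simp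
qed

lemma X_zero [simp]: "X 0 i = 0" and Y_zero [simp]: "Y 0 i = 0"
  using X_scale[of 0 0 i] Y_scale[of 0 0 i] by auto

sublocale quadratic_space scale Basis B Q
proof unfold_locales
  fix x y z :: 'v and c :: 'k
  show "B (x + y) z = B x z + B y z"
    by (simp add: B_def X_add Y_add distrib_right flip: sum.distrib) (simp add: add_ac)
  show "B (c \<cdot> x) z = c * B x z"
    by (simp add: B_def X_scale Y_scale sum_distrib_left distrib_left mult.assoc)
  show "B x y = B y x"
    unfolding B_def by (rule sum.cong) (simp_all add: mult.commute add.commute)
  show "Q (x + y) = Q x + Q y + B x y"
    by (simp add: B_def Q_def X_add Y_add distrib_left distrib_right flip: sum.distrib)
      (simp add: add_ac mult.commute)
  show "Q (c \<cdot> x) = c\<^sup>2 * Q x"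
    by (simp add: Q_def X_scale Y_scale sum_distrib_left power2_eq_square mult_ac)
  show "(1 :: 'k) + 1 = 0" by (rule char_2)
next
  fix x assume B0: "\<And>y. B x y = 0"
  show "x = 0"
  proof (rule coord_inj)
    fix i assume i: "i < n"
    obtain u v where
      u: "\<And>j. j < n \<Longrightarrow> X u j = (if j = i then 1 else 0) \<and> Y u j = 0" and
      v: "\<And>j. j < n \<Longrightarrow> X v j = 0 \<and> Y v j = (if j = i then 1 else 0)"
      using coord_surj[of "\<lambda>j. if j = i then 1 else 0" "\<lambda>_. 0"]
        coord_surj[of "\<lambda>_. 0" "\<lambda>j. if j = i then 1 else 0"] by blast
    show "X x i = X 0 i \<and> Y x i = Y 0 i"
      using B_unit[OF i u, of x] B_unit'[OF i v, of x] B0 by simp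
  qed
qed

section \<open>Coordinate subspaces\<close>

text \<open>The set is a graph: the \<open>X\<close>-coordinates in \<open>J\<close> and the
  \<open>Y\<close>-coordinates in \<open>K\<close> are free and determine the others.
  \<open>restrict\<close> ensures that \<open>F\<close> and \<open>G\<close> see the free ones
  only.\<close>

lemma card_graph:
  assumes J: "J \<subseteq> {..<n}" and K: "K \<subseteq> {..<n}"
  shows "card {x. (\<forall>i<n. i \<notin> J \<longrightarrow> X x i = F i (restrict (X x) J) (restrict (Y x) K)) \<and>
      (\<forall>i<n. i \<notin> K \<longrightarrow> Y x i = G i (restrict (X x) J) (restrict (Y x) K))}
    = CARD('k) ^ (card J + card K)" (is "card ?S = _")
proof -
  have "bij_betw (\<lambda>x. (restrict (X x) J, restrict (Y x) K)) ?S ((J \<rightarrow>\<^sub>E UNIV) \<times> (K \<rightarrow>\<^sub>E UNIV))"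
  proof (rule bij_betw_imageI)
    show "inj_on (\<lambda>x. (restrict (X x) J, restrict (Y x) K)) ?S"
    proof (rule inj_onI)
      fix x y assume x: "x \<in> ?S" and y: "y \<in> ?S"
        and eq: "(restrict (X x) J, restrict (Y x) K) = (restrict (X y) J, restrict (Y y) K)"
      have "X x i = X y i" if "i \<in> J" for i using eq that by (metis Pair_inject restrict_apply')
      moreover have "Y x i = Y y i" if "i \<in> K" for i
        using eq that by (metis Pair_inject restrict_apply')
      moreover have "X x i = X y i" if "i < n" "i \<notin> J" for i
        using x y eq that by simp
      moreover have "Y x i = Y y i" if "i < n" "i \<notin> K" for i
        using x y eq that by simp
      ultimately show "x = y" by (intro coord_inj) blast
    qed
    show "(\<lambda>x. (restrict (X x) J, restrict (Y x) K)) ` ?S = (J \<rightarrow>\<^sub>E UNIV) \<times> (K \<rightarrow>\<^sub>E UNIV)"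
    proof (intro equalityI subsetI)
      fix gh :: "(nat \<Rightarrow> 'k) \<times> (nat \<Rightarrow> 'k)"
      assume "gh \<in> (J \<rightarrow>\<^sub>E UNIV) \<times> (K \<rightarrow>\<^sub>E UNIV)"
      then obtain g h where gh: "gh = (g, h)" "g \<in> J \<rightarrow>\<^sub>E UNIV" "h \<in> K \<rightarrow>\<^sub>E UNIV" by auto
      obtain x where x: "\<forall>i<n. X x i = (if i \<in> J then g i else F i g h) \<and>
          Y x i = (if i \<in> K then h i else G i g h)"
        using coord_surj[of "\<lambda>i. if i \<in> J then g i else F i g h" "\<lambda>i. if i \<in> K then h i else G i g h"]
        by blast
      have "restrict (X x) J = g"
        using x J by (intro PiE_ext[OF _ gh(2)]) auto
      moreover have "restrict (Y x) K = h"
        using x K by (intro PiE_ext[OF _ gh(3)]) auto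
      ultimately have "gh = (restrict (X x) J, restrict (Y x) K)" using gh by simp
      then show "gh \<in> (\<lambda>x. (restrict (X x) J, restrict (Y x) K)) ` ?S"
        using x gh by (intro image_eqI[of _ _ x]) auto
    qed (elim imageE, simp)
  qed
  then have "card ?S = card ((J \<rightarrow>\<^sub>E (UNIV :: 'k set)) \<times> (K \<rightarrow>\<^sub>E (UNIV :: 'k set)))"
    by (rule bij_betw_same_card)
  moreover have "finite J" "finite K" using J K finite_subset by auto
  ultimately show ?thesis
    by (simp add: card_cartesian_product card_PiE power_add)
qed

lemma dim_space: "dim (UNIV :: 'v set) = 2 * n"
proof (rule dim_eqI)
  \<comment> \<open>With all coordinates free both conditions are vacuous, so any \<open>F\<close>
    and \<open>G\<close> serve.\<close>
  have "CARD('v) = CARD('k) ^ (card {..<n} + card {..<n})"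
    using card_graph[OF order_refl order_refl, of undefined undefined] by simp
  then show "CARD('v) = CARD('k) ^ (2 * n)"
    unfolding mult_2 card_lessThan .
qed simp

lemma singular_coordinate_space:
  assumes J: "J \<subseteq> {..<n}"
  defines "P \<equiv> {x. \<forall>i<n. (i \<notin> J \<longrightarrow> X x i = 0) \<and> Y x i = 0}"
  shows "subspace P" "dim P = card J" "x \<in> P \<Longrightarrow> Q x = 0"
    and "perp P = {x. \<forall>i\<in>J. Y x i = 0}"
proof -
  show P: "subspace P"
    by (rule subspaceI) (simp_all add: P_def X_add Y_add X_scale Y_scale)
  have "P = {x. (\<forall>i<n. i \<notin> J \<longrightarrow> X x i = 0) \<and> (\<forall>i<n. i \<notin> {} \<longrightarrow> Y x i = 0)}"
    by (auto simp: P_def)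
  then show "dim P = card J"
    using card_graph[OF J, of "{}" "\<lambda>_ _ _. 0" "\<lambda>_ _ _. 0"] by (intro dim_eqI[OF P]) simp
  show "Q x = 0" if "x \<in> P"
    using that by (simp add: Q_def P_def)
  show "perp P = {x. \<forall>i\<in>J. Y x i = 0}"
  proof (intro equalityI subsetI CollectI ballI)
    fix x i assume x: "x \<in> perp P" and i: "i \<in> J"
    obtain u where u: "\<And>j. j < n \<Longrightarrow> X u j = (if j = i then 1 else 0) \<and> Y u j = 0"
      using coord_surj[of "\<lambda>j. if j = i then 1 else 0" "\<lambda>_. 0"] by blast
    have "u \<in> P" using u i by (auto simp: P_def)
    then show "Y x i = 0" using x B_unit[OF _ u, of x] i J by (auto simp: perp_def)
  next
    fix x assume x: "x \<in> {x. \<forall>i\<in>J. Y x i = 0}"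
    have "B x y = 0" if y: "y \<in> P" for y
      unfolding B_def
    proof (rule sum.neutral, rule ballI)
      fix i assume "i \<in> {..<n}"
      then show "X x i * Y y i + Y x i * X y i = 0"
        using x y by (cases "i \<in> J") (auto simp: P_def)
    qed
    then show "x \<in> perp P" by (simp add: perp_def)
  qed
qed

text \<open>The vectors with all \<open>Y\<close>-coordinates zero form a totally singular
  \<open>P\<close> with \<open>perp P = P\<close>, so the hyperbolic case applies with
  \<open>dim P = n\<close>.\<close>

lemma card_level_UNIV:
  assumes n: "0 < n" and a: "a \<noteq> 0"
  shows "card (level UNIV a) + CARD('k) ^ (n - 1) = CARD('k) ^ (2 * n - 1)"
proof -
  define P where "P = {x. \<forall>i<n. (i \<notin> {..<n} \<longrightarrow> X x i = 0) \<and> Y x i = 0}"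
  note P = singular_coordinate_space[OF order_refl, folded P_def]
  have perp: "perp P = P" using P(4) by (auto simp: P_def)
  have "CARD('k) * card (level UNIV a) + CARD('k) ^ dim P = CARD('k) ^ dim (UNIV :: 'v set)"
    by (rule card_level_hyperbolic[OF subspace_UNIV P(1) subset_UNIV P(3) _ _ a])
      (simp_all only: perp Int_UNIV_left)
  moreover have "2 * n = Suc (2 * n - 1)" "n = Suc (n - 1)" using n by simp_all
  ultimately have "CARD('k) * card (level UNIV a) + CARD('k) ^ Suc (n - 1) = CARD('k) ^ Suc (2 * n - 1)"
    using P(2) dim_space by (metis card_lessThan)
  then have "CARD('k) * (card (level UNIV a) + CARD('k) ^ (n - 1)) = CARD('k) * CARD('k) ^ (2 * n - 1)"
    unfolding power_Suc distrib_left .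
  then show ?thesis
    using CARD_ge_2 by (metis mult_cancel1 not_numeral_le_zero)
qed

section \<open>Subspaces attaining the bounds\<close>

text \<open>On the hyperplane \<open>X x 0 = Y x 0\<close> the first product becomes a square. With
  \<open>P\<close> spanned by the remaining \<open>X\<close>-directions, \<open>W / P\<close> is a
  line on which the form is that square.\<close>

lemma ex_parabolic_subspace:
  assumes n: "0 < n" and a: "a \<noteq> 0"
  obtains U where "subspace U" "dim U = 2 * n - 1" "card (level U a) = CARD('k) ^ (2 * n - 2)"
proof -
  define P where "P = {x. \<forall>i<n. (i \<notin> {1..<n} \<longrightarrow> X x i = 0) \<and> Y x i = 0}"
  have J: "{1..<n} \<subseteq> {..<n}" by auto
  note P = singular_coordinate_space[OF J, folded P_def]
  define U where "U = {x. X x 0 = Y x 0}"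
  have U: "subspace U"
    by (rule subspaceI) (simp_all add: U_def X_add Y_add X_scale Y_scale)
  have W: "subspace (U \<inter> perp P)" using U subspace_perp by (rule subspace_inter)
  have U': "U = {x. (\<forall>i<n. i \<notin> {1..<n} \<longrightarrow> X x i = restrict (Y x) {..<n} 0) \<and>
      (\<forall>i<n. i \<notin> {..<n} \<longrightarrow> Y x i = 0)}"
    using n by (auto simp: U_def not_le)
  have "dim U = card {1..<n} + card {..<n}"
    using card_graph[OF J order_refl, of "\<lambda>_ _ h. h 0" "\<lambda>_ _ _. 0", folded U'] by (rule dim_eqI[OF U])
  then have dU: "dim U = Suc (2 * n - 2)" using n by simp
  have K: "{0} \<subseteq> {..<n}" using n by auto
  have W': "U \<inter> perp P = {x. (\<forall>i<n. i \<notin> {1..<n} \<longrightarrow> X x i = restrict (Y x) {0} 0) \<and>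
      (\<forall>i<n. i \<notin> {0} \<longrightarrow> Y x i = 0)}"
    using n unfolding P(4) by (auto simp: U_def not_le)
  have "dim (U \<inter> perp P) = card {1..<n} + card {0::nat}"
    using card_graph[OF J K, of "\<lambda>_ _ h. h 0" "\<lambda>_ _ _. 0", folded W'] by (rule dim_eqI[OF W])
  then have dW: "dim (U \<inter> perp P) = dim P + 1" using P(2) by simp
  have PU: "P \<subseteq> U" using n by (auto simp: P_def U_def)
  have sing: "x \<in> P" if x: "x \<in> U \<inter> perp P" "Q x = 0" for x
  proof -
    have Y0: "Y x i = 0" if "i \<in> {1..<n}" for i using x that unfolding P(4) by auto
    have "Q x = (\<Sum>i\<in>{0}. X x i * Y x i)"
      unfolding Q_def by (rule sum.mono_neutral_right) (use n Y0 in auto)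
    then have "X x 0 = 0 \<and> Y x 0 = 0" using x by (auto simp: U_def)
    then show ?thesis
      using Y0 by (auto simp: P_def not_le) (metis One_nat_def Suc_leI atLeastLessThan_iff gr0I)
  qed
  have "card (level U a) = CARD('k) ^ (2 * n - 2)"
    by (rule card_level_parabolic[OF U P(1) PU P(3) sing dW a dU])
  moreover have "dim U = 2 * n - 1" using dU n by simp
  ultimately show thesis using that U by blast
qed

text \<open>In the coordinates \<open>X\<^sub>0 = u\<close>, \<open>Y\<^sub>0 = u + v\<close>, \<open>X\<^sub>1 = \<alpha> v\<close>, \<open>Y\<^sub>1 = v\<close> the form restricts to
  \<open>u\<^sup>2 + u v + \<alpha> v\<^sup>2\<close>, which is anisotropic for a suitable \<open>\<alpha>\<close>.\<close>

lemma ex_elliptic_subspace: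
  assumes p: "p + 2 \<le> n" and t: "t \<le> p" and a: "a \<noteq> 0"
  obtains U where "subspace U" "dim U = p + t + 2"
    "card (level U a) = CARD('k) ^ (p + t + 1) + CARD('k) ^ p"
proof -
  \<comment> \<open>The map takes the value 0 at both 0 and -1, so on a finite field it misses some
    value \<open>\<alpha>\<close>.\<close>
  have "\<not> inj (\<lambda>z :: 'k. - (z\<^sup>2 + z))"
  proof
    assume "inj (\<lambda>z :: 'k. - (z\<^sup>2 + z))"
    then have "(0 :: 'k) = - 1" by (rule injD) simp
    then show False by simp
  qed
  then obtain \<alpha> :: 'k where \<alpha>: "\<And>z. - (z\<^sup>2 + z) \<noteq> \<alpha>"
    using finite_UNIV_surj_inj[of "\<lambda>z :: 'k. - (z\<^sup>2 + z)"] finite[of UNIV] unfolding surj_def by metis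
  define P where "P = {x. \<forall>i<n. (i \<notin> {2..<p+2} \<longrightarrow> X x i = 0) \<and> Y x i = 0}"
  have J: "{2..<p+2} \<subseteq> {..<n}" using p by auto
  note P = singular_coordinate_space[OF J, folded P_def]
  \<comment> \<open>The anisotropic plane, the \<open>p\<close> directions of \<open>P\<close>, and
    the duals of \<open>s\<close> of these. Intersecting with \<open>perp P\<close> removes the
    duals and leaves \<open>U 0\<close>.\<close>
  define U where "U s = {x. Y x 0 = X x 0 + Y x 1 \<and> X x 1 = \<alpha> * Y x 1 \<and>
    (\<forall>i<n. p + 2 \<le> i \<longrightarrow> X x i = 0) \<and> (\<forall>i<n. s + 2 \<le> i \<longrightarrow> Y x i = 0)}" for s
  have U: "subspace (U s)" for s
    by (rule subspaceI)
      (simp_all add: U_def X_add Y_add X_scale Y_scale distrib_left mult.left_commute add_ac)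
  have dU: "dim (U s) = p + s + 2" if s: "s \<le> p" for s
  proof -
    let ?J = "insert 0 {2..<p+2}" and ?K = "insert 1 {2..<s+2}"
    have JK: "?J \<subseteq> {..<n}" "?K \<subseteq> {..<n}" using p s by auto
    have "U s = {x. (\<forall>i<n. i \<notin> ?J \<longrightarrow> X x i = (if i = 1 then \<alpha> * restrict (Y x) ?K 1 else 0)) \<and>
        (\<forall>i<n. i \<notin> ?K \<longrightarrow> Y x i = (if i = 0 then restrict (X x) ?J 0 + restrict (Y x) ?K 1 else 0))}"
      (is "_ = ?S")
    proof (intro equalityI subsetI)
      fix x assume "x \<in> U s"
      then show "x \<in> ?S" by (auto simp: U_def not_le not_less)
    next
      fix x assume "x \<in> ?S"
      then have X1: "\<And>i. i < n \<Longrightarrow> i \<notin> ?J \<Longrightarrow> X x i = (if i = 1 then \<alpha> * Y x 1 else 0)"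
        and Y1: "\<And>i. i < n \<Longrightarrow> i \<notin> ?K \<Longrightarrow> Y x i = (if i = 0 then X x 0 + Y x 1 else 0)"
        by simp_all
      show "x \<in> U s"
        unfolding U_def using X1[of 1] Y1[of 0] X1 Y1 p by auto
    qed
    then have "card (U s) = CARD('k) ^ (card ?J + card ?K)"
      using card_graph[OF JK, of "\<lambda>i g h. if i = 1 then \<alpha> * h 1 else 0"
          "\<lambda>i g h. if i = 0 then g 0 + h 1 else 0"] by (simp only:)
    then have "dim (U s) = card ?J + card ?K" by (rule dim_eqI[OF U])
    then show ?thesis by simp
  qed
  have W: "U t \<inter> perp P = U 0"
    unfolding P(4) using p t by (fastforce simp: U_def not_le)
  have PU: "P \<subseteq> U t" using p by (auto simp: P_def U_def)
  have sing: "x \<in> P" if x: "x \<in> U t \<inter> perp P" "Q x = 0" for x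
  proof -
    have xU: "x \<in> U 0" using x(1) unfolding W .
    have "Q x = (\<Sum>i\<in>{0, 1}. X x i * Y x i)"
      unfolding Q_def by (rule sum.mono_neutral_right) (use p xU in \<open>auto simp: U_def\<close>)
    then have *: "X x 0 * (X x 0 + Y x 1) + \<alpha> * Y x 1 * Y x 1 = 0"
      using x(2) xU by (simp add: U_def)
    have Y1: "Y x 1 = 0"
    proof (rule ccontr)
      assume nz: "Y x 1 \<noteq> 0"
      \<comment> \<open>Dividing the equation by the square of \<open>Y x 1\<close> would make
        \<open>z\<close> a root of \<open>z\<^sup>2 + z + \<alpha>\<close>, excluded by the choice
        of \<open>\<alpha>\<close>.\<close>
      define z where "z = X x 0 / Y x 1"
      have "X x 0 = z * Y x 1" using nz by (simp add: z_def)
      then have "(z\<^sup>2 + z + \<alpha>) * (Y x 1 * Y x 1) = 0"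
        using * by (simp add: power2_eq_square algebra_simps)
      then have "z\<^sup>2 + z + \<alpha> = 0" using nz by (metis mult_eq_0_iff)
      then have "- (z\<^sup>2 + z) = \<alpha>" by (rule minus_unique)
      then show False using \<alpha> by blast
    qed
    then have "X x 0 = 0" using * by simp
    have "X x i = 0" if i: "i < n" "i \<notin> {2..<p+2}" for i
    proof -
      consider "i = 0" | "i = 1" | "p + 2 \<le> i" using i by fastforce
      then show ?thesis using xU Y1 \<open>X x 0 = 0\<close> i by cases (auto simp: U_def)
    qed
    moreover have "Y x i = 0" if "i < n" for i
    proof -
      consider "i = 0" | "i = 1" | "2 \<le> i" by linarith
      then show ?thesis using xU Y1 \<open>X x 0 = 0\<close> that by cases (auto simp: U_def)
    qed
    ultimately show ?thesis by (simp add: P_def)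
  qed
  have dW: "dim (U t \<inter> perp P) = dim P + 2"
    unfolding W using dU[of 0] P(2) by simp
  have dUt: "dim (U t) = Suc (p + t + 1)" using dU[OF t] by simp
  have "dim P = p" using P(2) by simp
  then have "card (level (U t) a) = CARD('k) ^ (p + t + 1) + CARD('k) ^ p"
    using card_level_elliptic[OF U P(1) PU P(3) sing dW a dUt] by (simp only:)
  then show thesis using that[OF U] dU[OF t] by blast
qed

section \<open>The maximal number of solutions in each dimension\<close>

text \<open>A predicate rather than a \<open>Max\<close>: attainment and upper bound are the two
  facts that the weight computation consumes.\<close>

definition max_level :: "'k \<Rightarrow> nat \<Rightarrow> nat \<Rightarrow> bool" where
  "max_level a s N \<longleftrightarrow> (\<exists>U. subspace U \<and> dim U = s \<and> card (level U a) = N) \<and>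
    (\<forall>U. subspace U \<longrightarrow> dim U = s \<longrightarrow> card (level U a) \<le> N)"

lemma card_level_bound:
  assumes n: "0 < n" and a: "a \<noteq> 0" and U: "subspace U" "dim U = Suc d"
  shows "card (level U a) \<le> CARD('k) ^ d \<or>
    (\<exists>p. Suc p \<le> d \<and> p + 2 \<le> n \<and> d \<le> 2 * p + 1 \<and>
      card (level U a) = CARD('k) ^ d + CARD('k) ^ p)"
proof (rule card_level_le[OF U(1) a U(2) dim_space])
  have "0 < CARD('k) ^ (n - 1)" by simp
  then show "card (level UNIV a) < CARD('k) ^ (2 * n - 1)"
    using card_level_UNIV[OF n a] by linarith
qed

text \<open>A surplus would need \<open>2 * n - 2 \<le> 2 * p + 1\<close> with
  \<open>p \<le> n - 2\<close>, which is impossible.\<close>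

lemma max_level_hyperplane:
  assumes n: "0 < n" and a: "a \<noteq> 0"
  shows "max_level a (2 * n - 1) (CARD('k) ^ (2 * n - 2))"
  unfolding max_level_def
proof (intro conjI allI impI)
  show "\<exists>U. subspace U \<and> dim U = 2 * n - 1 \<and> card (level U a) = CARD('k) ^ (2 * n - 2)"
    using ex_parabolic_subspace[OF n a] by metis
next
  fix U assume U: "subspace U" "dim U = 2 * n - 1"
  then have "dim U = Suc (2 * n - 2)" using n by simp
  from card_level_bound[OF n a U(1) this]
  show "card (level U a) \<le> CARD('k) ^ (2 * n - 2)" using n by fastforce
qed

text \<open>The constraint \<open>p + 2 \<le> n\<close> is decisive; \<open>p = n - 2\<close> is
  reached by the elliptic construction with \<open>t = s - n\<close>.\<close>

lemma max_level_large:
  assumes n: "2 \<le> n" and s: "n \<le> s" "s \<le> 2 * n - 2" and a: "a \<noteq> 0"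
  shows "max_level a s (CARD('k) ^ (s - 1) + CARD('k) ^ (n - 2))"
  unfolding max_level_def
proof (intro conjI allI impI)
  have "n - 2 + 2 \<le> n" "s - n \<le> n - 2" using n s by auto
  then obtain U where "subspace U" "dim U = n - 2 + (s - n) + 2"
    "card (level U a) = CARD('k) ^ (n - 2 + (s - n) + 1) + CARD('k) ^ (n - 2)"
    using ex_elliptic_subspace[OF _ _ a] by blast
  moreover have "n - 2 + (s - n) + 2 = s" "n - 2 + (s - n) + 1 = s - 1" using n s by auto
  ultimately show "\<exists>U. subspace U \<and> dim U = s \<and>
      card (level U a) = CARD('k) ^ (s - 1) + CARD('k) ^ (n - 2)"
    by (simp only:) blast
next
  fix U assume U: "subspace U" "dim U = s"
  then have "dim U = Suc (s - 1)" "0 < n" using n s by auto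
  from card_level_bound[OF this(2) a U(1) this(1)]
  show "card (level U a) \<le> CARD('k) ^ (s - 1) + CARD('k) ^ (n - 2)"
  proof (elim disjE exE conjE)
    fix p assume "p + 2 \<le> n" and eq: "card (level U a) = CARD('k) ^ (s - 1) + CARD('k) ^ p"
    then have "CARD('k) ^ p \<le> CARD('k) ^ (n - 2)"
      using CARD_ge_2 by (intro power_increasing) linarith+
    then show ?thesis unfolding eq by (rule add_left_mono)
  qed (rule trans_le_add1)
qed

text \<open>Here \<open>Suc p \<le> s - 1\<close> is decisive; \<open>p = s - 2\<close> is reached
  with \<open>t = 0\<close>.\<close>

lemma max_level_small:
  assumes s: "2 \<le> s" "s \<le> n" and a: "a \<noteq> 0"
  shows "max_level a s (CARD('k) ^ (s - 1) + CARD('k) ^ (s - 2))"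
  unfolding max_level_def
proof (intro conjI allI impI)
  have "s - 2 + 2 \<le> n" "0 \<le> s - 2" using s by auto
  then obtain U where "subspace U" "dim U = s - 2 + 0 + 2"
    "card (level U a) = CARD('k) ^ (s - 2 + 0 + 1) + CARD('k) ^ (s - 2)"
    using ex_elliptic_subspace[OF _ _ a] by blast
  moreover have "s - 2 + 0 + 2 = s" "s - 2 + 0 + 1 = s - 1" using s by auto
  ultimately show "\<exists>U. subspace U \<and> dim U = s \<and>
      card (level U a) = CARD('k) ^ (s - 1) + CARD('k) ^ (s - 2)"
    by (simp only:) blast
next
  fix U assume U: "subspace U" "dim U = s"
  then have "dim U = Suc (s - 1)" "0 < n" using s by auto
  from card_level_bound[OF this(2) a U(1) this(1)]
  show "card (level U a) \<le> CARD('k) ^ (s - 1) + CARD('k) ^ (s - 2)"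
  proof (elim disjE exE conjE)
    fix p assume "Suc p \<le> s - 1" and eq: "card (level U a) = CARD('k) ^ (s - 1) + CARD('k) ^ p"
    then have "CARD('k) ^ p \<le> CARD('k) ^ (s - 2)"
      using CARD_ge_2 by (intro power_increasing) linarith+
    then show ?thesis unfolding eq by (rule add_left_mono)
  qed (rule trans_le_add1)
qed

text \<open>For \<open>d = 0\<close> no \<open>p\<close> qualifies, so the bound is
  \<open>q ^ 0\<close>. A vector of value \<open>a\<close> exists by the count for the whole space,
  and its span attains 1.\<close>

lemma max_level_line:
  assumes n: "0 < n" and a: "a \<noteq> 0"
  shows "max_level a 1 1"
  unfolding max_level_def
proof (intro conjI allI impI)
  have bound: "card (level U a) \<le> 1" if "subspace U" "dim U = 1" for U
    using card_level_bound[OF n a that(1), of 0] that(2) by simp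
  have "CARD('k) ^ (n - 1) < CARD('k) ^ (2 * n - 1)"
    using n CARD_ge_2 by (intro power_strict_increasing) auto
  then have "card (level UNIV a) \<noteq> 0" using card_level_UNIV[OF n a] by linarith
  then obtain v where v: "Q v = a" by fastforce
  have "level (span {v}) a \<noteq> {}" using v span_base[of v "{v}"] by auto
  then have "card (level (span {v}) a) \<noteq> 0" by simp
  moreover have d: "dim (span {v}) = 1" using v a by auto
  ultimately have "card (level (span {v}) a) = 1"
    using bound[OF subspace_span d] by linarith
  then show "\<exists>U. subspace U \<and> dim U = 1 \<and> card (level U a) = 1" using d subspace_span by blast
  show "card (level U a) \<le> 1" if "subspace U" "dim U = 1" for U by (rule bound[OF that])
qed

lemma max_level_point:
  assumes a: "a \<noteq> 0"
  shows "max_level a 0 0"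
proof -
  have "card (level U a) = 0" if "dim U = 0" for U
    using that a by auto
  moreover have "dim {0} = 0" by simp
  ultimately have "\<exists>U. subspace U \<and> dim U = 0 \<and> card (level U a) = 0"
    using subspace_single_0 by blast
  then show ?thesis unfolding max_level_def
    using eq_refl[OF \<open>\<And>U. dim U = 0 \<Longrightarrow> card (level U a) = 0\<close>] by blast
qed

end

subsection \<open>The trace form and trace codes\<close>

text \<open>Translation by 1 permutes the field; comparing the sums of all elements gives
  \<open>2 ^ e = 0\<close> in it.\<close>

lemma finite_field_char_2:
  assumes "CARD('a::{field,finite}) = 2 ^ e"
  shows "(1 :: 'a) + 1 = 0"
proof -
  have "bij (\<lambda>x :: 'a. x + 1)"
    by (rule bij_betw_byWitness[where f' = "\<lambda>x. x - 1"]) auto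
  then have "(\<Sum>x\<in>UNIV. x + 1) = \<Sum>(UNIV :: 'a set)"
    by (rule sum.reindex_bij_betw)
  then have "of_nat CARD('a) = (0 :: 'a)"
    by (simp add: sum.distrib)
  then have "(2 :: 'a) ^ e = 0" unfolding assms by simp
  then have "(2 :: 'a) = 0" by (metis power_not_zero)
  then show ?thesis by simp
qed

text \<open>Multiplication by a nonzero \<open>x\<close> permutes the nonzero elements; comparing
  products gives the claim.\<close>

lemma finite_field_power_card:
  fixes x :: "'a::{field,finite}"
  shows "x ^ CARD('a) = x"
proof (cases "x = 0")
  case False
  have "bij_betw (\<lambda>y. x * y) (- {0}) (- {0})"
    by (rule bij_betw_byWitness[where f' = "\<lambda>y. y / x"]) (use False in auto)
  then have "(\<Prod>y\<in>- {0}. x * y) = \<Prod>(- {0 :: 'a})"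
    by (rule prod.reindex_bij_betw)
  then have "x ^ card (- {0 :: 'a}) * \<Prod>(- {0 :: 'a}) = 1 * \<Prod>(- {0 :: 'a})"
    by (simp add: prod.distrib)
  moreover have "\<Prod>(- {0 :: 'a}) \<noteq> 0" by simp
  ultimately have "x ^ card (- {0 :: 'a}) = 1" using mult_right_cancel by blast
  moreover have "CARD('a) = Suc (card (- {0 :: 'a}))"
    by (simp add: Compl_eq_Diff_UNIV card_Diff_subset)
  ultimately show ?thesis by simp
qed simp

lemma power_2_power_add:
  fixes x y :: "'a::comm_ring_1"
  assumes "(1 :: 'a) + 1 = 0"
  shows "(x + y) ^ (2 ^ j) = x ^ (2 ^ j) + y ^ (2 ^ j)"
proof (induction j)
  case (Suc j)
  have two: "(2 :: 'a) = 0" using assms by simp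
  have "(x + y) ^ (2 ^ Suc j) = (x ^ (2 ^ j) + y ^ (2 ^ j))\<^sup>2"
    by (simp only: Suc power_Suc2 power_mult)
  also have "\<dots> = (x ^ (2 ^ j))\<^sup>2 + (y ^ (2 ^ j))\<^sup>2"
    unfolding power2_sum two by simp
  finally show ?case by (simp only: power_Suc2 power_mult)
qed simp

section \<open>The trace of the extension\<close>

locale char_2_extension = field_embedding emb
  for emb :: "'k::{field,finite} \<Rightarrow> 'l::{field,finite}" +
  fixes m e :: nat and \<epsilon> :: "nat \<Rightarrow> 'l"
  assumes card_k: "CARD('k) = 2 ^ e" and card_l: "CARD('l) = CARD('k) ^ m" and m_pos: "0 < m"
    and basis: "is_ext_basis emb m \<epsilon>"
begin

sublocale finite_vector_space "ext_scale emb" "\<epsilon> ` {1..m}"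
proof -
  interpret vector_space "ext_scale emb"
    by (rule vector_space_ext_scale) (rule field_embedding_axioms)
  show "finite_vector_space (ext_scale emb) (\<epsilon> ` {1..m})"
    by unfold_locales (use basis in \<open>auto simp: is_ext_basis_def\<close>)
qed

lemma dim_UNIV_eq: "dim (UNIV :: 'l set) = m"
  by (rule dim_eqI) (simp_all add: card_l)

lemma emb_zero: "emb 0 = 0"
  using emb_add[of 0 0] by (metis add_cancel_right_right)

lemma inj_emb: "inj emb"
proof (rule injI)
  fix x y assume eq: "emb x = emb y"
  have "emb x = emb (x - y) + emb y" by (simp flip: emb_add)
  then have "emb (x - y) = 0" using eq by simp
  then have "emb ((x - y) * inverse (x - y)) = 0" by (simp add: emb_mult)
  then have "(x - y) * inverse (x - y) \<noteq> 1" using emb_one by auto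
  then have "x - y = 0" using right_inverse by blast
  then show "x = y" by simp
qed

lemma char_2_l: "(1 :: 'l) + 1 = 0"
  using emb_add[of 1 1] emb_one emb_zero finite_field_char_2[OF card_k] by simp

lemma frobenius_add: "(x + y :: 'l) ^ (CARD('k) ^ i) = x ^ (CARD('k) ^ i) + y ^ (CARD('k) ^ i)"
  unfolding card_k power_mult[symmetric] by (rule power_2_power_add[OF char_2_l])

lemma frobenius_sum: "finite A \<Longrightarrow> (\<Sum>i\<in>A. g i :: 'l) ^ CARD('k) = (\<Sum>i\<in>A. g i ^ CARD('k))"
proof (induction A rule: finite_induct)
  case (insert i A)
  then show ?case using frobenius_add[of "g i" "sum g A" 1] by simp
qed (simp add: power_0_left)

text \<open>The elements of the subfield are roots of the polynomial \<open>y ^ q - y\<close>, which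
  has at most \<open>q\<close> roots.\<close>

lemma range_emb: "range emb = {y. y ^ CARD('k) = y}"
proof (rule card_seteq)
  show "range emb \<subseteq> {y. y ^ CARD('k) = y}"
  proof clarify
    fix x :: 'k
    have "emb (x ^ j) = emb x ^ j" for j by (induction j) (simp_all add: emb_one emb_mult)
    then show "emb x ^ CARD('k) = emb x" by (metis finite_field_power_card)
  qed
  define p :: "'l poly" where "p = monom 1 CARD('k) - monom 1 1"
  have "coeff p CARD('k) = 1" using CARD_ge_2 by (simp add: p_def)
  then have "p \<noteq> 0" by auto
  have "degree p \<le> CARD('k)"
    unfolding p_def by (rule degree_diff_le) (use CARD_ge_2 in \<open>simp_all add: degree_monom_eq\<close>)
  moreover have "{y. y ^ CARD('k) = y} = {y. poly p y = 0}"
    by (simp add: p_def poly_monom)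
  ultimately show "card {y :: 'l. y ^ CARD('k) = y} \<le> card (range emb)"
    using card_poly_roots_bound[OF \<open>p \<noteq> 0\<close>] by (simp add: card_image[OF inj_emb])
qed simp

lemma emb_field_trace: "emb (field_trace emb m x) = (\<Sum>i<m. x ^ (CARD('k) ^ i))"
proof -
  have "(\<Sum>i<m. x ^ (CARD('k) ^ i)) ^ CARD('k) = (\<Sum>i<m. x ^ (CARD('k) ^ Suc i))"
    by (simp only: frobenius_sum finite_lessThan power_mult[symmetric] power_Suc2)
  \<comment> \<open>Raising to the power \<open>q\<close> shifts the summands by one place, and
    \<open>x ^ (q ^ m) = x\<close> closes the cycle. So the sum is fixed and \<open>inv emb\<close>
    really inverts \<open>emb\<close> on it.\<close>
  moreover have "x + (\<Sum>i<m. x ^ (CARD('k) ^ Suc i)) = (\<Sum>i<m. x ^ (CARD('k) ^ i)) + x"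
    using sum.lessThan_Suc_shift[of "\<lambda>i. x ^ (CARD('k) ^ i)" m]
      finite_field_power_card[of x, unfolded card_l]
    by (simp only: sum.lessThan_Suc power_0 power_one_right)
  ultimately have "(\<Sum>i<m. x ^ (CARD('k) ^ i)) ^ CARD('k) = (\<Sum>i<m. x ^ (CARD('k) ^ i))"
    by (metis add.commute add_left_cancel)
  then have "(\<Sum>i<m. x ^ (CARD('k) ^ i)) \<in> range emb"
    unfolding range_emb by simp
  then show ?thesis unfolding field_trace_def by (rule f_inv_into_f)
qed

lemma field_trace_add: "field_trace emb m (x + y) = field_trace emb m x + field_trace emb m y"
  by (rule injD[OF inj_emb]) (simp only: emb_add emb_field_trace frobenius_add sum.distrib)

lemma field_trace_scale: "field_trace emb m (ext_scale emb c x) = c * field_trace emb m x"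
proof (rule injD[OF inj_emb])
  have "emb c ^ (CARD('k) ^ i) = emb c" for i
  proof (induction i)
    case (Suc i)
    have "emb c ^ CARD('k) = emb c" using range_emb by blast
    then show ?case by (simp only: power_Suc power_mult Suc)
  qed simp
  then show "emb (field_trace emb m (ext_scale emb c x)) = emb (c * field_trace emb m x)"
    by (simp add: emb_mult emb_field_trace ext_scale_def power_mult_distrib sum_distrib_left)
qed

text \<open>The trace is a nonzero polynomial of degree at most \<open>q ^ (m - 1)\<close>, too
  small to vanish at all \<open>q ^ m\<close> elements.\<close>

lemma field_trace_nonzero: "\<exists>x. field_trace emb m x \<noteq> 0"
proof (rule ccontr)
  assume "\<not> ?thesis"
  then have "(\<Sum>i<m. x ^ (CARD('k) ^ i)) = 0" for x :: 'l
    using emb_field_trace[of x] emb_zero by simp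
  define p :: "'l poly" where "p = (\<Sum>i<m. monom 1 (CARD('k) ^ i))"
  have p0: "poly p x = 0" for x
    using \<open>\<And>x. (\<Sum>i<m. x ^ (CARD('k) ^ i)) = 0\<close> by (simp add: p_def poly_sum poly_monom)
  have "coeff p (CARD('k) ^ (m - 1)) = (\<Sum>i<m. if i = m - 1 then 1 else 0)"
    unfolding p_def coeff_sum
    by (rule sum.cong) (use CARD_ge_2 in \<open>auto simp: power_inject_exp\<close>)
  also have "\<dots> = 1" using m_pos by simp
  finally have "p \<noteq> 0" by auto
  have "degree p \<le> CARD('k) ^ (m - 1)"
    unfolding p_def
  proof (rule degree_sum_le)
    fix i assume "i \<in> {..<m}"
    then have "CARD('k) ^ i \<le> CARD('k) ^ (m - 1)"
      using CARD_ge_2 by (intro power_increasing) auto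
    then show "degree (monom (1 :: 'l) (CARD('k) ^ i)) \<le> CARD('k) ^ (m - 1)"
      by (simp add: degree_monom_eq)
  qed simp
  also have "\<dots> < CARD('k) ^ m"
    using CARD_ge_2 m_pos by (intro power_strict_increasing) auto
  finally show False
    using card_poly_roots_bound[OF \<open>p \<noteq> 0\<close>] by (simp add: p0 card_l)
qed

sublocale trace: nondegenerate_form "ext_scale emb" "\<epsilon> ` {1..m}" "\<lambda>x y. field_trace emb m (x * y)"
proof unfold_locales
  fix x y z :: 'l and c
  show "field_trace emb m ((x + y) * z) = field_trace emb m (x * z) + field_trace emb m (y * z)"
    by (simp add: distrib_right field_trace_add)
  show "field_trace emb m (ext_scale emb c x * z) = c * field_trace emb m (x * z)"
    using field_trace_scale[of c "x * z"] by (simp add: ext_scale_def mult.assoc)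
  show "field_trace emb m (x * y) = field_trace emb m (y * x)"
    by (simp add: mult.commute)
next
  fix x :: 'l assume tr0: "\<And>y. field_trace emb m (x * y) = 0"
  obtain z where z: "field_trace emb m z \<noteq> 0" using field_trace_nonzero by blast
  show "x = 0"
  proof (rule ccontr)
    assume "x \<noteq> 0"
    then have "x * (z / x) = z" by simp
    then show False using tr0[of "z / x"] z by simp
  qed
qed

section \<open>Weights of trace codes\<close>

text \<open>If \<open>x \<noteq> y\<close> gave the same codeword, all \<open>\<delta> i\<close>
  would lie in the hyperplane orthogonal to \<open>x - y\<close>.\<close>

lemma trace_code_injective:
  fixes \<delta> :: "'n::finite \<Rightarrow> 'l"
  assumes "\<And>U. subspace U \<Longrightarrow> dim U = m - 1 \<Longrightarrow> \<exists>i. \<delta> i \<notin> U"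
  shows "inj (\<lambda>x. \<chi> i. field_trace emb m (x * \<delta> i))"
proof (rule injI)
  fix x y assume eq: "(\<chi> i. field_trace emb m (x * \<delta> i)) = (\<chi> i. field_trace emb m (y * \<delta> i))"
  have 0: "field_trace emb m ((x - y) * \<delta> i) = 0" for i
    using eq field_trace_add[of "(x - y) * \<delta> i" "y * \<delta> i"]
    by (simp add: vec_eq_iff flip: distrib_right)
  show "x = y"
  proof (rule ccontr)
    assume "x \<noteq> y"
    then have d: "dim (span {x - y}) = 1" by simp
    have "\<delta> i \<in> trace.perp (span {x - y})" for i
    proof -
      have "field_trace emb m (\<delta> i * z) = 0" if "z \<in> span {x - y}" for z
        using that 0[of i] by (auto simp: span_singleton trace.B_scale_right mult.commute)
      then show ?thesis by (simp add: trace.perp_def)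
    qed
    moreover have "dim (trace.perp (span {x - y})) = m - 1"
      using trace.dim_perp[of "span {x - y}"] d dim_UNIV_eq by simp
    ultimately show False using assms trace.subspace_perp by blast
  qed
qed

text \<open>By injectivity the subcodes of dimension \<open>r\<close> are the images of the
  subspaces \<open>S\<close> of dimension \<open>r\<close>, and \<open>perp\<close> exchanges these
  with the subspaces of dimension \<open>m - r\<close> in \<open>ex\<close> and
  \<open>le\<close>.\<close>

lemma gen_hamming_weight_trace_code:
  fixes \<delta> :: "'n::finite \<Rightarrow> 'l"
  assumes inj: "inj (\<lambda>x. \<chi> i. field_trace emb m (x * \<delta> i))" and r: "r \<le> m"
    and ex: "\<exists>U. subspace U \<and> dim U = m - r \<and> card {i. \<delta> i \<in> U} = M"
    and le: "\<And>U. subspace U \<Longrightarrow> dim U = m - r \<Longrightarrow> card {i. \<delta> i \<in> U} \<le> M"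
  shows "gen_hamming_weight (trace_code emb m \<delta>) r + M = CARD('n)"
    and "vec.subspace (trace_code emb m \<delta>)" and "vec.dim (trace_code emb m \<delta>) = m"
proof -
  \<comment> \<open>Makes \<open>dim_eqI\<close> available for codes, so that the dimension of an
    image is read off from its cardinality.\<close>
  interpret V: finite_vector_space "(*s) :: 'k \<Rightarrow> 'k ^ 'n \<Rightarrow> 'k ^ 'n" cart_basis
    by unfold_locales
  define ev where "ev x = (\<chi> i. field_trace emb m (x * \<delta> i))" for x
  have ev_add: "ev (x + y) = ev x + ev y" and ev_scale: "ev (ext_scale emb c x) = c *s ev x" for x y c
    using trace.B_scale
    by (simp_all add: ev_def vec_eq_iff trace.B_add)
  have ev_zero: "ev 0 = 0" using ev_scale[of 0 0] by simp
  have code: "trace_code emb m \<delta> = range ev" by (auto simp: trace_code_def ev_def)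
  have inj_ev: "inj ev" using inj unfolding ev_def[abs_def] .
  have image: "vec.subspace (ev ` S)" "vec.dim (ev ` S) = dim S" if S: "subspace S" for S
  proof -
    show sub: "vec.subspace (ev ` S)"
    proof (rule vec.subspaceI)
      show "0 \<in> ev ` S" using ev_zero subspace_0[OF S] by (metis imageI)
      show "u + v \<in> ev ` S" if "u \<in> ev ` S" "v \<in> ev ` S" for u v
        using that subspace_add[OF S] by (auto simp flip: ev_add)
      show "c *s u \<in> ev ` S" if "u \<in> ev ` S" for c u
        using that subspace_scale[OF S] by (auto simp flip: ev_scale)
    qed
    show "vec.dim (ev ` S) = dim S"
      using card_subspace[OF S] card_image[OF inj_on_subset[OF inj_ev subset_UNIV], of S]
      by (intro V.dim_eqI[OF sub]) simp
  qed
  show "vec.subspace (trace_code emb m \<delta>)" "vec.dim (trace_code emb m \<delta>) = m"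
    unfolding code using image[OF subspace_UNIV] dim_UNIV_eq by simp_all
  have supp: "card (code_supp (ev ` S)) + card {i. \<delta> i \<in> trace.perp S} = CARD('n)" for S
  proof -
    have "code_supp (ev ` S) = - {i. \<delta> i \<in> trace.perp S}"
      by (auto simp: code_supp_def ev_def trace.perp_def mult.commute)
    then have "CARD('n) = card (code_supp (ev ` S) \<union> {i. \<delta> i \<in> trace.perp S})" by simp
    also have "\<dots> = card (code_supp (ev ` S)) + card {i. \<delta> i \<in> trace.perp S}"
      by (rule card_Un_disjoint) (use \<open>code_supp (ev ` S) = _\<close> in auto)
    finally show ?thesis by simp
  qed
  define A where "A = {card (code_supp H) | H. vec.subspace H \<and> H \<subseteq> range ev \<and> vec.dim H = r}"
  have "Min A = CARD('n) - M"
  proof (rule Min_eqI)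
    have "A = (\<lambda>H. card (code_supp H)) ` {H. vec.subspace H \<and> H \<subseteq> range ev \<and> vec.dim H = r}"
      by (auto simp: A_def)
    then show "finite A" by simp
    fix w assume "w \<in> A"
    then obtain H where H: "w = card (code_supp H)" "vec.subspace H" "H \<subseteq> range ev" "vec.dim H = r"
      by (auto simp: A_def)
    define S where "S = ev -` H"
    have "ev ` S = H" using H(3) by (auto simp: S_def)
    have S: "subspace S"
      by (rule subspaceI) (simp_all add: S_def ev_zero ev_add ev_scale H(2) vec.subspace_0
          vec.subspace_add vec.subspace_scale)
    have "dim S = r" using image(2)[OF S] H(4) \<open>ev ` S = H\<close> by simp
    then have "dim (trace.perp S) = m - r" using trace.dim_perp[OF S] dim_UNIV_eq by simp
    then have "card {i. \<delta> i \<in> trace.perp S} \<le> M" using le trace.subspace_perp by blast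
    then show "CARD('n) - M \<le> w" using supp[of S] H(1) \<open>ev ` S = H\<close> by simp
  next
    obtain U where U: "subspace U" "dim U = m - r" "card {i. \<delta> i \<in> U} = M" using ex by blast
    have "dim (trace.perp U) = r" using trace.dim_perp[OF U(1)] dim_UNIV_eq U(2) r by simp
    moreover have "card (code_supp (ev ` trace.perp U)) = CARD('n) - M"
      using supp[of "trace.perp U"] U trace.perp_perp[OF U(1)] by simp
    ultimately show "CARD('n) - M \<in> A"
      unfolding A_def using image[OF trace.subspace_perp, of U]
      by (intro CollectI exI[of _ "ev ` trace.perp U"]) auto
  qed
  moreover have "M \<le> CARD('n)" using ex by (auto intro: card_mono)
  ultimately show "gen_hamming_weight (trace_code emb m \<delta>) r + M = CARD('n)"
    unfolding gen_hamming_weight_def code A_def by simp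
qed

section \<open>Coordinates and forms of Type I\<close>

lemma ext_coord_add: "ext_coord emb m \<epsilon> (x + y) i = ext_coord emb m \<epsilon> x i + ext_coord emb m \<epsilon> y i"
  using representation_add[OF independent_Basis, of y x] span_Basis by (simp add: ext_coord_def)

lemma ext_coord_scale: "ext_coord emb m \<epsilon> (ext_scale emb c x) i = c * ext_coord emb m \<epsilon> x i"
  using representation_scale[OF independent_Basis, of x c] span_Basis by (simp add: ext_coord_def)

lemma ext_coord_inj:
  assumes "\<And>i. i \<in> {1..m} \<Longrightarrow> ext_coord emb m \<epsilon> x i = ext_coord emb m \<epsilon> y i"
  shows "x = y"
proof -
  let ?r = "representation (\<epsilon> ` {1..m})"
  have "?r x b = ?r y b" for b
  proof (cases "b \<in> \<epsilon> ` {1..m}")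
    case False
    then show ?thesis using representation_ne_zero[of "\<epsilon> ` {1..m}" _ b] by metis
  qed (use assms in \<open>auto simp: ext_coord_def\<close>)
  then have "?r x = ?r y" by blast
  then show ?thesis
    using sum_nonzero_representation_eq[OF independent_Basis, of x]
      sum_nonzero_representation_eq[OF independent_Basis, of y] unfolding span_Basis by simp
qed

lemma ext_coord_surj: "\<exists>x. \<forall>i\<in>{1..m}. ext_coord emb m \<epsilon> x i = g i"
proof (intro exI ballI)
  fix i assume i: "i \<in> {1..m}"
  let ?x = "\<Sum>j\<in>{1..m}. ext_scale emb (g j) (\<epsilon> j)"
  have zero: "ext_coord emb m \<epsilon> 0 i = 0" using ext_coord_scale[of 0 0 i] by simp
  have "ext_coord emb m \<epsilon> (\<Sum>j\<in>J. h j) i = (\<Sum>j\<in>J. ext_coord emb m \<epsilon> (h j) i)" if "finite J" for J h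
    using that by (induction J rule: finite_induct) (simp_all add: zero ext_coord_add)
  from this[OF finite_atLeastAtMost, of "\<lambda>j. ext_scale emb (g j) (\<epsilon> j)" 1 m]
  have "ext_coord emb m \<epsilon> ?x i = (\<Sum>j\<in>{1..m}. g j * ext_coord emb m \<epsilon> (\<epsilon> j) i)"
    unfolding ext_coord_scale .
  also have "\<dots> = (\<Sum>j\<in>{1..m}. if j = i then g j else 0)"
  proof (rule sum.cong[OF refl])
    fix j assume j: "j \<in> {1..m}"
    have "\<epsilon> j = \<epsilon> i \<longleftrightarrow> j = i"
      using basis i j unfolding is_ext_basis_def by (meson inj_on_eq_iff)
    then show "g j * ext_coord emb m \<epsilon> (\<epsilon> j) i = (if j = i then g j else 0)"
      using representation_basis[OF independent_Basis imageI[OF j]] by (auto simp: ext_coord_def)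
  qed
  also have "\<dots> = g i" using i by simp
  finally show "ext_coord emb m \<epsilon> ?x i = g i" .
qed

text \<open>Pulling the basis coordinates back along \<open>T\<close> turns \<open>f\<close> into
  the standard form. Its pairs \<open>(2 * i - 1, 2 * i)\<close> counted from 1 become
  \<open>(2 * i + 1, 2 * i + 2)\<close> counted from 0.\<close>

lemma hyperbolic_type_I:
  assumes lin: "Vector_Spaces.linear (ext_scale emb) (ext_scale emb) T" and bij: "bij T"
    and m: "m = 2 * n"
  shows "hyperbolic_space (ext_scale emb) (\<epsilon> ` {1..m}) n
    (\<lambda>x i. ext_coord emb m \<epsilon> (inv T x) (Suc (2 * i)))
    (\<lambda>x i. ext_coord emb m \<epsilon> (inv T x) (Suc (Suc (2 * i))))"
proof -
  interpret T: Vector_Spaces.linear "ext_scale emb" "ext_scale emb" T by (rule lin)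
  have add: "inv T (x + y) = inv T x + inv T y" for x y
    by (rule injD[OF bij_is_inj[OF bij]]) (simp add: T.add surj_f_inv_f[OF bij_is_surj[OF bij]])
  have scale: "inv T (ext_scale emb c x) = ext_scale emb c (inv T x)" for c x
    by (rule injD[OF bij_is_inj[OF bij]]) (simp add: T.scale surj_f_inv_f[OF bij_is_surj[OF bij]])
  show ?thesis
  proof unfold_locales
    fix x y
    assume eq: "\<And>i. i < n \<Longrightarrow>
      ext_coord emb m \<epsilon> (inv T x) (Suc (2 * i)) = ext_coord emb m \<epsilon> (inv T y) (Suc (2 * i)) \<and>
      ext_coord emb m \<epsilon> (inv T x) (Suc (Suc (2 * i))) = ext_coord emb m \<epsilon> (inv T y) (Suc (Suc (2 * i)))"
    have "inv T x = inv T y"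
    proof (rule ext_coord_inj)
      fix i assume i: "i \<in> {1..m}"
      show "ext_coord emb m \<epsilon> (inv T x) i = ext_coord emb m \<epsilon> (inv T y) i"
      proof (cases "even i")
        case True
        then obtain j where "i = 2 * j" by blast
        then have "i = 2 * (j - 1) + 2" "j - 1 < n" using i m by auto
        then show ?thesis using eq[of "j - 1"] by simp
      next
        case False
        then obtain j where "i = 2 * j + 1" by (rule oddE)
        then have "j < n" using i m by auto
        then show ?thesis using eq[of j] \<open>i = 2 * j + 1\<close> by simp
      qed
    qed
    then show "x = y" using surj_f_inv_f[OF bij_is_surj[OF bij]] by metis
  next
    fix g h :: "nat \<Rightarrow> 'k"
    \<comment> \<open>\<open>g\<close> and \<open>h\<close> are interleaved: the odd place
      \<open>2 * k + 1\<close> holds \<open>g k\<close>, the even place \<open>2 * k + 2\<close>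
      holds \<open>h k\<close>.\<close>
    obtain z where z: "\<And>i. i \<in> {1..m} \<Longrightarrow> ext_coord emb m \<epsilon> z i =
        (if odd i then g (i div 2) else h (i div 2 - 1))"
      using ext_coord_surj[of "\<lambda>i. if odd i then g (i div 2) else h (i div 2 - 1)"] by blast
    show "\<exists>x. \<forall>i<n. ext_coord emb m \<epsilon> (inv T x) (Suc (2 * i)) = g i \<and>
        ext_coord emb m \<epsilon> (inv T x) (Suc (Suc (2 * i))) = h i"
    proof (intro exI[of _ "T z"] allI impI)
      fix i assume "i < n"
      then have "Suc (2 * i) \<in> {1..m}" "Suc (Suc (2 * i)) \<in> {1..m}" using m by auto
      from z[OF this(1)] z[OF this(2)]
      show "ext_coord emb m \<epsilon> (inv T (T z)) (Suc (2 * i)) = g i \<and>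
          ext_coord emb m \<epsilon> (inv T (T z)) (Suc (Suc (2 * i))) = h i"
        by (simp add: inv_f_f[OF bij_is_inj[OF bij]])
    qed
    show "(1 :: 'k) + 1 = 0" by (rule finite_field_char_2[OF card_k])
  qed (simp_all add: add scale ext_coord_add ext_coord_scale)
qed

end

section \<open>The weight hierarchy\<close>

theorem theorem1:
  fixes emb :: "'k::{field,finite} \<Rightarrow> 'l::{field,finite}"
    and q m e :: nat
    and a :: 'k
    and \<epsilon> :: "nat \<Rightarrow> 'l"
    and f :: "'l \<Rightarrow> 'k"
    and \<delta> :: "'n::finite \<Rightarrow> 'l"
  assumes emb: "field_embedding emb"
    and card_k: "CARD('k) = q"
    and card_l: "CARD('l) = q ^ m"
    and q: "q = 2 ^ e"
    and m: "even m" "m > 0"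
    and not_2_2: "(q, m) \<noteq> (2, 2)"
    and a: "a \<noteq> 0"
    and basis: "is_ext_basis emb m \<epsilon>"
    and form: "is_quadratic_form emb m \<epsilon> f"
    and nondeg: "nondegenerate f"
    and typeI: "is_type_I emb m \<epsilon> f"
    and enum: "bij_betw \<delta> UNIV {x. f x = a}"
  shows "vec.subspace (trace_code emb m \<delta>) \<and>
    vec.dim (trace_code emb m \<delta>) = m \<and>
    (\<forall>r\<in>{1..m}.
      (r = 1 \<longrightarrow>
        int (gen_hamming_weight (trace_code emb m \<delta>) r)
          = int q ^ (m - 1) - int q ^ ((m - 2) div 2) - int q ^ (m - 2)) \<and>
      (2 \<le> r \<and> r \<le> m div 2 \<longrightarrow>
        int (gen_hamming_weight (trace_code emb m \<delta>) r)
          = int q ^ (m - 1) - int q ^ ((m - 2) div 2) - int q ^ (m - r - 1) - int q ^ ((m - 4) div 2)) \<and>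
      (m div 2 < r \<and> r < m - 1 \<longrightarrow>
        int (gen_hamming_weight (trace_code emb m \<delta>) r)
          = int q ^ (m - 1) - int q ^ ((m - 2) div 2) - int q ^ (m - r - 1) - int q ^ (m - r - 2)) \<and>
      (r = m - 1 \<longrightarrow>
        int (gen_hamming_weight (trace_code emb m \<delta>) r)
          = int q ^ (m - 1) - int q ^ ((m - 2) div 2) - 1) \<and>
      (r = m \<longrightarrow>
        int (gen_hamming_weight (trace_code emb m \<delta>) r)
          = int q ^ (m - 1) - int q ^ ((m - 2) div 2)))"
proof -
  interpret E: char_2_extension emb m e \<epsilon>
    using emb card_k card_l q m basis by (simp add: char_2_extension_def char_2_extension_axioms_def)
  define n where "n = m div 2"
  have mn: "m = 2 * n" and n: "0 < n" using m by (auto simp: n_def)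
  have "form_rank emb m f = m"
    using nondeg by (simp add: form_rank_def nondegenerate_def)
  then obtain T where T: "Vector_Spaces.linear (ext_scale emb) (ext_scale emb) T" "bij T"
    and fT: "\<And>x. f (T x) = type_I_form emb m \<epsilon> m x"
    using typeI by (auto simp: is_type_I_def equivalent_forms_def)
  interpret H: hyperbolic_space "ext_scale emb" "\<epsilon> ` {1..m}" n
    "\<lambda>x i. ext_coord emb m \<epsilon> (inv T x) (Suc (2 * i))"
    "\<lambda>x i. ext_coord emb m \<epsilon> (inv T x) (Suc (Suc (2 * i)))"
    by (rule E.hyperbolic_type_I[OF T mn])
  have Q: "H.Q x = f x" for x
  proof -
    have "f x = type_I_form emb m \<epsilon> m (inv T x)"
      using fT[of "inv T x"] surj_f_inv_f[OF bij_is_surj[OF T(2)]] by simp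
    also have "\<dots> = H.Q x"
      unfolding type_I_form_def H.Q_def by (simp add: n_def sum.atLeast1_atMost_eq)
    finally show ?thesis by simp
  qed
  have level: "card {i. \<delta> i \<in> U} = card {x\<in>U. H.Q x = a}" for U
  proof (rule bij_betw_same_card)
    show "bij_betw \<delta> {i. \<delta> i \<in> U} {x\<in>U. H.Q x = a}"
      using enum by (auto simp: bij_betw_def Q inj_on_def)
  qed
  have length: "CARD('n) + q ^ (n - 1) = q ^ (m - 1)"
    using H.card_level_UNIV[OF n a] level[of UNIV] unfolding mn[symmetric] card_k by simp
  have max_hyperplane: "H.max_level a (m - 1) (q ^ (m - 2))"
    using H.max_level_hyperplane[OF n a] unfolding mn[symmetric] card_k .
  have q2: "2 \<le> q" using E.CARD_ge_2 card_k by simp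
  \<comment> \<open>No hyperplane contains the defining set: it has
    \<open>q ^ (m - 1) - q ^ (n - 1)\<close> points, a hyperplane at most \<open>q ^ (m - 2)\<close>
    of them. Hence the code has full dimension \<open>m\<close>.\<close>
  have hyperplane: "\<exists>i. \<delta> i \<notin> U" if U: "E.subspace U" "E.dim U = m - 1" for U
  proof (rule ccontr)
    assume "\<not> ?thesis"
    then have "CARD('n) \<le> q ^ (m - 2)"
      using max_hyperplane U level[of U] unfolding H.max_level_def by simp
    then have le: "q ^ (m - 1) \<le> q ^ (m - 2) + q ^ (n - 1)" using length by simp
    show False
    proof (cases "n = 1")
      \<comment> \<open>For \<open>m = 2\<close> the inequality \<open>le\<close> reads
        \<open>q \<le> 2\<close>, so only the excluded pair \<open>(2, 2)\<close> could satisfy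
        it.\<close>
      case True
      then show False using le not_2_2 q2 mn by simp
    next
      case False
      then have "q ^ (n - 1) < q ^ (m - 2)"
        using n mn q2 by (intro power_strict_increasing) auto
      moreover have "2 * q ^ (m - 2) \<le> q * q ^ (m - 2)" using q2 by (rule mult_le_mono1)
      moreover have "Suc (m - 2) = m - 1" using n mn by simp
      then have "q * q ^ (m - 2) = q ^ (m - 1)" by (metis power_Suc)
      ultimately show False using le by linarith
    qed
  qed
  have inj: "inj (\<lambda>x. \<chi> i. field_trace emb m (x * \<delta> i))"
    by (rule E.trace_code_injective) (rule hyperplane)
  have weight: "gen_hamming_weight (trace_code emb m \<delta>) r + M = CARD('n)"
    and code: "vec.subspace (trace_code emb m \<delta>)" "vec.dim (trace_code emb m \<delta>) = m"
    if "r \<le> m" "H.max_level a (m - r) M" for r M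
    using E.gen_hamming_weight_trace_code[OF inj that(1), of M] that(2)
    unfolding H.max_level_def level by blast+
  have weight': "int (gen_hamming_weight (trace_code emb m \<delta>) r)
      = int q ^ (m - 1) - int q ^ ((m - 2) div 2) - int M"
    if "r \<le> m" "H.max_level a (m - r) M" for r M
  proof -
    have "n - 1 = (m - 2) div 2" using mn by simp
    have "gen_hamming_weight (trace_code emb m \<delta>) r + M + q ^ ((m - 2) div 2) = q ^ (m - 1)"
      using weight[OF that] length \<open>n - 1 = (m - 2) div 2\<close> by simp
    then have "int (gen_hamming_weight (trace_code emb m \<delta>) r) + int M + int q ^ ((m - 2) div 2)
        = int q ^ (m - 1)"
      by (metis of_nat_add of_nat_power)
    then show ?thesis by linarith
  qed
  note point = H.max_level_point[OF a]
  show ?thesis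
  \<comment> \<open>With \<open>s = m - r\<close> the five cases are hyperplanes,
    \<open>n \<le> s \<le> 2 * n - 2\<close>, \<open>2 \<le> s < n\<close>, lines and the zero
    space. For \<open>m = 2\<close> the first and the fourth both apply to \<open>r = 1\<close>,
    with the same value.\<close>
  proof (intro conjI ballI impI)
    show "vec.subspace (trace_code emb m \<delta>)" "vec.dim (trace_code emb m \<delta>) = m"
      using code[of m 0] point by simp_all
  next
    fix r assume "r \<in> {1..m}" and r: "r = 1"
    show "int (gen_hamming_weight (trace_code emb m \<delta>) r)
        = int q ^ (m - 1) - int q ^ ((m - 2) div 2) - int q ^ (m - 2)"
      using weight'[of r "q ^ (m - 2)"] max_hyperplane r m by simp
  next
    fix r assume "r \<in> {1..m}" and r: "2 \<le> r \<and> r \<le> m div 2"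
    have "2 \<le> n" "n \<le> m - r" "m - r \<le> 2 * n - 2" using r mn by auto
    then have "H.max_level a (m - r) (q ^ (m - r - 1) + q ^ (n - 2))"
      using H.max_level_large[OF _ _ _ a] unfolding card_k by blast
    moreover have "n - 2 = (m - 4) div 2" using mn by simp
    ultimately show "int (gen_hamming_weight (trace_code emb m \<delta>) r)
        = int q ^ (m - 1) - int q ^ ((m - 2) div 2) - int q ^ (m - r - 1) - int q ^ ((m - 4) div 2)"
      using weight'[of r "q ^ (m - r - 1) + q ^ (n - 2)"] \<open>r \<in> {1..m}\<close> by simp
  next
    fix r assume "r \<in> {1..m}" and r: "m div 2 < r \<and> r < m - 1"
    have "2 \<le> m - r" "m - r \<le> n" using r mn by auto
    then have "H.max_level a (m - r) (q ^ (m - r - 1) + q ^ (m - r - 2))"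
      using H.max_level_small[OF _ _ a] unfolding card_k by blast
    then show "int (gen_hamming_weight (trace_code emb m \<delta>) r)
        = int q ^ (m - 1) - int q ^ ((m - 2) div 2) - int q ^ (m - r - 1) - int q ^ (m - r - 2)"
      using weight'[of r "q ^ (m - r - 1) + q ^ (m - r - 2)"] \<open>r \<in> {1..m}\<close> by simp
  next
    fix r assume "r \<in> {1..m}" and r: "r = m - 1"
    have "m - r = 1" using r m by simp
    then show "int (gen_hamming_weight (trace_code emb m \<delta>) r)
        = int q ^ (m - 1) - int q ^ ((m - 2) div 2) - 1"
      using weight'[of r 1] H.max_level_line[OF n a] r by simp
  next
    fix r assume "r \<in> {1..m}" and r: "r = m"
    then show "int (gen_hamming_weight (trace_code emb m \<delta>) r)
        = int q ^ (m - 1) - int q ^ ((m - 2) div 2)"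
      using weight'[of m 0] point by simp
  qed
qed

end
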